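(* A Nash equilibrium always exists for the $\eta$-noisy Bayesian persuasion game: there is a strategy profile $(\pi_1,\dots,\pi_N)\in S_1\times\cdots\times S_N$ such that for every agent $i$ and every $\pi_i'\in S_i$, $U_i(\pi_1,\dots,\pi_N)\ge U_i(\pi_1,\dots,\pi_{i-1},\pi_i',\pi_{i+1},\dots,\pi_N)$.
   Context: The $\eta$-noisy Bayesian persuasion game. Let $1\le k\le N$ be integers, $0<\underline v<1$, $0<\eta<1$, and $I_v=I_m=I=[\underline v,1]$. Agent $i\in[N]$ has a prior $\mathcal F_i$, a probability distribution on $I$. The strategy space $S_i$ of agent $i$ is the set of probability measures $\pi_i$ on $I_v\times I_m$ (value, message) such that (a) the marginal of $\pi_i$ on $I_v$ is $\mathcal F_i$; (b) for every continuous function $h$ on $I_m$, $\int_{I_v\times I_m}(v-m)h(m)\,d\pi_i(v,m)=0$ (i.e. $\mathbb E[v_i\mid m_i]=m_i$ almost surely). Given $(\pi_1,\dots,\pi_N)$, the pairs $(v_i,m_i)\sim\pi_i$ are drawn independently, and independent noises $\xi_i\sim\mathrm{Uniform}[1-\eta,1+\eta]$ are drawn. The principal observes $y_i=m_i\xi_i$ and selects the $k$ agents with the highest $y_i$, breaking ties uniformly at random; $\rho_i(\boldsymbol m,\boldsymbol\xi)$ is the resulting probability that $i$ is selected. Agent $i$ receives $u_i(v_i)$ if selected and $0$ otherwise, where $u_i:I\to\mathbb R_{\ge0}$ is continuous and weakly increasing. Expected utility: $U_i(\pi_1,\dots,\pi_N)=\mathbb E[\rho_i(\boldsymbol m,\boldsymbol\xi)\,u_i(v_i)]$.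 *)

theory Defs
  imports "HOL-Probability.Probability"
begin

text \<open>
  The space of this measure is the interval itself, so that a utility or test function
  that is continuous on the interval is measurable, whatever its values outside.
\<close>

definition borel_I :: "real \<Rightarrow> real measure" where
  "borel_I vmin = restrict_space borel {vmin..1}"

definition is_prior :: "real \<Rightarrow> real measure \<Rightarrow> bool" where
  "is_prior vmin F \<longleftrightarrow> prob_space F \<and> sets F = sets (borel_I vmin)"

text \<open>The first coordinate is the value, the second one the message.\<close>

definition strategies :: "real \<Rightarrow> real measure \<Rightarrow> (real \<times> real) measure set" where
  "strategies vmin F = {p.
     prob_space p \<and> sets p = sets (borel_I vmin \<Otimes>\<^sub>M borel_I vmin) \<and>
     distr p (borel_I vmin) fst = F \<and>
     (\<forall>h :: real \<Rightarrow> real. continuous_on {vmin..1} h \<longrightarrow>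
        (\<integral>x. (fst x - snd x) * h (snd x) \<partial>p) = 0)}"

definition top_sets :: "nat \<Rightarrow> nat \<Rightarrow> (nat \<Rightarrow> real) \<Rightarrow> nat set set" where
  "top_sets N k y =
     {T. T \<subseteq> {..<N} \<and> card T = k \<and> (\<forall>i\<in>T. \<forall>j\<in>{..<N} - T. y j \<le> y i)}"

text \<open>
  Breaking ties uniformly at random means that the selected set is uniformly distributed
  over all sets of k agents with the highest observations.
\<close>

definition selection_prob ::
  "nat \<Rightarrow> nat \<Rightarrow> nat \<Rightarrow> (nat \<Rightarrow> real) \<Rightarrow> (nat \<Rightarrow> real) \<Rightarrow> real" where
  "selection_prob N k i m \<xi> =
     measure_pmf.prob (pmf_of_set (top_sets N k (\<lambda>j. m j * \<xi> j))) {T. i \<in> T}"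

definition noise :: "real \<Rightarrow> real measure" where
  "noise \<eta> = uniform_measure lborel {1 - \<eta>..1 + \<eta>}"

definition expected_utility ::
  "nat \<Rightarrow> nat \<Rightarrow> real \<Rightarrow> (nat \<Rightarrow> real \<Rightarrow> real) \<Rightarrow> nat \<Rightarrow> (nat \<Rightarrow> (real \<times> real) measure) \<Rightarrow> real" where
  "expected_utility N k \<eta> u i \<pi> =
     (\<integral>(x, \<xi>). selection_prob N k i (\<lambda>j. snd (x j)) \<xi> * u i (fst (x i))
        \<partial>(PiM {..<N} \<pi> \<Otimes>\<^sub>M PiM {..<N} (\<lambda>_. noise \<eta>)))"

definition nash_equilibrium ::
  "'i set \<Rightarrow> ('i \<Rightarrow> 's set) \<Rightarrow> ('i \<Rightarrow> ('i \<Rightarrow> 's) \<Rightarrow> real) \<Rightarrow> ('i \<Rightarrow> 's) \<Rightarrow> bool" where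
  "nash_equilibrium A S U p \<longleftrightarrow>
     (\<forall>i\<in>A. p i \<in> S i) \<and> (\<forall>i\<in>A. \<forall>q\<in>S i. U i p \<ge> U i (p(i := q)))"

end

theory Submission
  imports Defs
begin

text \<open>
  Each strategy set is convex and, in the weak topology, sequentially compact, and the utilities
  are affine in every coordinate. They are also weakly continuous, although the selection rule is
  not continuous in the messages: since messages are positive and the noise has no atoms, ties have
  probability 0, and off ties the selected set is locally constant. Skorohod's representation then
  turns weak continuity into dominated convergence.

  The function \<open>\<psi>(\<pi>, \<rho>) = \<Sum>\<^sub>i (U\<^sub>i(\<rho>\<^sub>i, \<pi>\<^sub>-\<^sub>i) - U\<^sub>i(\<pi>))\<close> is affine in \<open>\<rho>\<close> and vanishes on the
  diagonal. For finitely many \<open>\<rho>\<close>, Brouwer's theorem on the simplex of their mixtures gives a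
  \<open>\<pi>\<close> with \<open>\<psi>(\<pi>, \<rho>) \<le> 0\<close> for all of them; finite nets and compactness extend this to all \<open>\<rho>\<close>
  (Ky Fan's inequality). Such a \<open>\<pi>\<close> is an equilibrium.
\<close>

text \<open>The inequality stands in for the theorems of Kakutani and Glicksberg because it asks
  only for sequences and for Brouwer's theorem in finite dimension: no vector space of measures, no
  set-valued map. The delicate point is that strategies must be mixed agent by agent, since a
  mixture of product measures would correlate the agents. A payoff is affine in each coordinate but,
  in the common weights of a mixed profile, only polynomial. So \<psi> is affine in its second
  argument, where each summand sees a single coordinate of \<rho>, while in the first argument only
  continuity in the weights is available, and this is what Brouwer's theorem asks for. The noise is
  averaged out before the strategies vary, because the selection rule itself jumps at ties. A tie in
  which both messages vanish would survive any multiplicative noise; this is the role of the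
  positive lower bound. The function \<psi> is known as the Nikaido-Isoda function.\<close>

section \<open>Ky Fan's inequality\<close>

text \<open>Finitely many coordinates call for no diagonal argument: each refinement keeps what the
  earlier ones achieved, by the second assumption. \<open>P j s\<close> will say that coordinate
  \<open>j\<close> converges along \<open>s\<close>.\<close>

lemma finite_common_subseq:
  fixes P :: "nat \<Rightarrow> (nat \<Rightarrow> nat) \<Rightarrow> bool"
  assumes "\<And>j s. j < N \<Longrightarrow> strict_mono (s :: nat \<Rightarrow> nat) \<Longrightarrow> \<exists>r. strict_mono r \<and> P j (s \<circ> r)"
    and "\<And>j s r. j < N \<Longrightarrow> P j s \<Longrightarrow> strict_mono r \<Longrightarrow> P j (s \<circ> r)"
  shows "\<exists>r. strict_mono r \<and> (\<forall>j<N. P j r)"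
  using assms
proof (induction N)
  case 0
  show ?case using strict_mono_id by auto
next
  case (Suc N)
  have "\<exists>r. strict_mono r \<and> (\<forall>j<N. P j r)"
    by (rule Suc.IH) (use Suc.prems in auto)
  then obtain s where s: "strict_mono s" "\<forall>j<N. P j s" by blast
  obtain r where r: "strict_mono r" "P N (s \<circ> r)"
    using Suc.prems(1)[OF lessI s(1)] by blast
  have "\<forall>j<Suc N. P j (s \<circ> r)"
    using s r Suc.prems(2)[of _ s r] by (auto simp only: less_Suc_eq)
  then show ?case
    using s(1) r(1) strict_mono_o by blast
qed

lemma convergent_subseq_coordinatewise:
  fixes X :: "nat \<Rightarrow> nat \<Rightarrow> real"
  assumes "\<And>n i. i < M \<Longrightarrow> X n i \<in> {a..b}"
  shows "\<exists>r x. strict_mono (r :: nat \<Rightarrow> nat) \<and> (\<forall>i<M. x i \<in> {a..b} \<and> (\<lambda>n. X (r n) i) \<longlonglongrightarrow> x i)"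
proof -
  define P where "P = (\<lambda>i s. \<exists>l\<in>{a..b}. (\<lambda>n. X (s n) i) \<longlonglongrightarrow> l)"
  have "\<exists>r. strict_mono r \<and> (\<forall>j<M. P j r)"
  proof (rule finite_common_subseq)
    fix j s assume j: "j < M" and "strict_mono (s :: nat \<Rightarrow> nat)"
    obtain l r where "l \<in> {a..b}" "strict_mono r" "((\<lambda>n. X (s n) j) \<circ> r) \<longlonglongrightarrow> l"
      using compact_Icc[of a b, unfolded compact_eq_seq_compact_metric seq_compact_def] assms j
      by meson
    then show "\<exists>r. strict_mono r \<and> P j (s \<circ> r)"
      unfolding P_def comp_def by blast
  next
    fix j s r assume "P j s" "strict_mono (r :: nat \<Rightarrow> nat)"
    then show "P j (s \<circ> r)"
      unfolding P_def using LIMSEQ_subseq_LIMSEQ by (fastforce simp: comp_def)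
  qed
  then obtain r where r: "strict_mono r" "\<forall>j<M. P j r" by blast
  then obtain x where "\<forall>j<M. x j \<in> {a..b} \<and> (\<lambda>n. X (r n) j) \<longlonglongrightarrow> x j"
    unfolding P_def Bex_def by metis
  then show ?thesis using r(1) by blast
qed

text \<open>
  The dimension is a number here, not a type, so that it can depend on the number of deviations
  under consideration; this is why the Brouwer theorem of the library does not apply.
\<close>

lemma brouwer_nat_cube:
  fixes f :: "(nat \<Rightarrow> real) \<Rightarrow> nat \<Rightarrow> real"
  assumes range: "\<And>x l. (\<And>i. i < M \<Longrightarrow> x i \<in> {0..1}) \<Longrightarrow> l < M \<Longrightarrow> f x l \<in> {0..1}"
    and cont: "\<And>X x l. (\<And>n i. i < M \<Longrightarrow> X n i \<in> {0..1}) \<Longrightarrow> (\<And>i. i < M \<Longrightarrow> x i \<in> {0..1}) \<Longrightarrow>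
      (\<And>i. i < M \<Longrightarrow> (\<lambda>n. X n i) \<longlonglongrightarrow> x i) \<Longrightarrow> l < M \<Longrightarrow> (\<lambda>n. f (X n) l) \<longlonglongrightarrow> f x l"
  obtains x where "\<And>i. i < M \<Longrightarrow> x i \<in> {0..1}" "\<And>i. i < M \<Longrightarrow> f x i = x i"
proof -
  \<comment> \<open>\<open>q\<close> will be a scaled grid point; at \<open>a\<close> the map
    \<open>f\<close> does not decrease coordinate \<open>i\<close>, at \<open>b\<close> it does not
    increase it. As the mesh 1 / (n + 1) shrinks, both points tend to the limit of \<open>q\<close>,
    which gives the two inequalities of \<open>f x i = x i\<close>.\<close>
  define near_fixed where "near_fixed n q a b i \<longleftrightarrow>
      (\<forall>j<M. a j \<in> {0..1} \<and> \<bar>a j - q j\<bar> \<le> 1 / real (Suc n) \<and>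
             b j \<in> {0..1} \<and> \<bar>b j - q j\<bar> \<le> 1 / real (Suc n)) \<and>
      a i \<le> f a i \<and> f b i \<le> b i" for n :: nat and q a b :: "nat \<Rightarrow> real" and i
  have "\<exists>q. (\<forall>i<M. q i \<in> {0..1}) \<and> (\<forall>i<M. \<exists>a b. near_fixed n q a b i)" for n
  proof -
    define p where "p = Suc n"
    define sc where "sc v = (\<lambda>j. real (v j) / real p)" for v :: "nat \<Rightarrow> nat"
    \<comment> \<open>Kuhn's lemma wants label 0 where a coordinate is 0 and label 1 where it is
      \<open>p\<close>. The first holds because \<open>f\<close> is nonnegative. The second is
      forced by the extra condition, and is harmless since there \<open>f\<close> is at most 1,
      which is \<open>sc v i\<close>.\<close>
    define label :: "(nat \<Rightarrow> nat) \<Rightarrow> nat \<Rightarrow> nat" where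
      "label v i = (if sc v i \<le> f (sc v) i \<and> v i \<noteq> p then 0 else 1)" for v i
    have sc: "sc v i \<in> {0..1}" if "v i \<le> p" for v i
      using that by (auto simp: sc_def p_def divide_simps)
    have f_sc: "f (sc v) i \<in> {0..1}" if "\<forall>i<M. v i \<le> p" "i < M" for v i
      using that sc by (intro range) auto
    obtain q where q: "\<forall>i<M. q i < p"
      and rs: "\<forall>i<M. \<exists>r s. (\<forall>j<M. q j \<le> r j \<and> r j \<le> q j + 1) \<and>
            (\<forall>j<M. q j \<le> s j \<and> s j \<le> q j + 1) \<and> label r i \<noteq> label s i"
    proof (rule kuhn_lemma[of p M label])
      show "0 < p" by (simp add: p_def)
      show "\<forall>x. (\<forall>i<M. x i \<le> p) \<longrightarrow> (\<forall>i<M. x i = 0 \<longrightarrow> label x i = 0)"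
        using f_sc by (auto simp: label_def sc_def p_def)
    qed (auto simp: label_def)
    have "\<exists>a b. near_fixed n (sc q) a b i" if i: "i < M" for i
    proof -
      \<comment> \<open>Kuhn's lemma only says that the two labels differ, so \<open>r\<close> and
        \<open>s\<close> may have to be swapped.\<close>
      have "label v i = 0 \<or> label v i = 1" for v by (simp add: label_def)
      then obtain r s where rs: "\<forall>j<M. q j \<le> r j \<and> r j \<le> q j + 1"
          "\<forall>j<M. q j \<le> s j \<and> s j \<le> q j + 1" "label r i = 0" "label s i = 1"
        using rs[rule_format, OF i] by metis
      have near: "sc v j \<in> {0..1} \<and> \<bar>sc v j - sc q j\<bar> \<le> 1 / real (Suc n)"
        if "q j \<le> v j \<and> v j \<le> q j + 1" "j < M" for v j
      proof -
        have "v j \<le> p" using that q by fastforce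
        moreover have "\<bar>sc v j - sc q j\<bar> = \<bar>real (v j) - real (q j)\<bar> / real p"
          unfolding sc_def by (simp flip: diff_divide_distrib)
        moreover have "\<bar>real (v j) - real (q j)\<bar> \<le> 1" using that by linarith
        ultimately show ?thesis using sc[of v j] by (simp add: p_def divide_right_mono)
      qed
      have "f (sc s) i \<in> {0..1}" using rs q i by (intro f_sc) fastforce+
      moreover have "sc s i = 1" if "s i = p" using that by (simp add: sc_def p_def)
      ultimately have "f (sc s) i \<le> sc s i"
        using rs(4) by (auto simp: label_def split: if_splits)
      moreover have "sc r i \<le> f (sc r) i"
        using rs(3) by (auto simp: label_def split: if_splits)
      ultimately show ?thesis
        unfolding near_fixed_def using near rs(1,2)
        by (intro exI[of _ "sc r"] exI[of _ "sc s"]) auto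
    qed
    moreover have "sc q i \<in> {0..1}" if "i < M" for i
      using q sc[of q i] that by (simp add: less_imp_le_nat)
    ultimately show ?thesis by blast
  qed
  then obtain q where q: "\<And>n i. i < M \<Longrightarrow> q n i \<in> {0..1}"
    and "\<forall>n. \<forall>i<M. \<exists>a b. near_fixed n (q n) a b i" by metis
  then obtain a b where "\<And>n i. i < M \<Longrightarrow> near_fixed n (q n) (a n i) (b n i) i" by metis
  note * = this[unfolded near_fixed_def]
  obtain r x where r: "strict_mono (r :: nat \<Rightarrow> nat)" and x: "\<And>i. i < M \<Longrightarrow> x i \<in> {0..1}"
    and lim: "\<And>i. i < M \<Longrightarrow> (\<lambda>n. q (r n) i) \<longlonglongrightarrow> x i"
    using convergent_subseq_coordinatewise[of M q 0 1] q by metis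
  have inv: "(\<lambda>n. 1 / real (Suc (r n))) \<longlonglongrightarrow> 0"
    using LIMSEQ_subseq_LIMSEQ[OF lim_inverse_n' r] LIMSEQ_subseq_LIMSEQ[OF LIMSEQ_inverse_real_of_nat r]
    by (simp add: comp_def inverse_eq_divide)
  have near: "(\<lambda>n. c (r n) j) \<longlonglongrightarrow> x j"
    if "\<And>n. \<bar>c n j - q n j\<bar> \<le> 1 / real (Suc n)" "j < M" for c :: "nat \<Rightarrow> nat \<Rightarrow> real" and j
  proof -
    have "(\<lambda>n. c (r n) j - q (r n) j) \<longlonglongrightarrow> 0"
      by (rule Lim_null_comparison[OF _ inv]) (use that in auto)
    from tendsto_add[OF this lim[OF that(2)]] show ?thesis by simp
  qed
  have "f x i = x i" if i: "i < M" for i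
  proof -
    have fa: "(\<lambda>n. f (a (r n) i) i) \<longlonglongrightarrow> f x i"
      using * i x near[of "\<lambda>n. a n i"] by (intro cont) auto
    have fb: "(\<lambda>n. f (b (r n) i) i) \<longlonglongrightarrow> f x i"
      using * i x near[of "\<lambda>n. b n i"] by (intro cont) auto
    have "x i \<le> f x i"
      by (rule LIMSEQ_le[OF near[of "\<lambda>n. a n i" i] fa]) (use * i in auto)
    moreover have "f x i \<le> x i"
      by (rule LIMSEQ_le[OF fb near[of "\<lambda>n. b n i" i]]) (use * i in auto)
    ultimately show ?thesis by simp
  qed
  with x show ?thesis using that by blast
qed

section \<open>The finite form of the inequality\<close>

definition simplex_weights :: "nat \<Rightarrow> (nat \<Rightarrow> real) set" where
  "simplex_weights M = {w. (\<forall>l<M. 0 \<le> w l) \<and> (\<Sum>l<M. w l) = 1}"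

text \<open>At a fixed point of Nash's map, \<open>w l * G = max 0 (g w l)\<close>, where
  \<open>G\<close> is the sum of the positive parts. If \<open>G\<close> were positive, the mean of
  \<open>g w\<close> under \<open>w\<close> would be the sum of the squares of these parts divided
  by \<open>G\<close>, hence positive, against \<open>diag\<close>.\<close>

lemma ky_fan_finite:
  fixes g :: "(nat \<Rightarrow> real) \<Rightarrow> nat \<Rightarrow> real"
  assumes "0 < M"
    and diag: "\<And>w. w \<in> simplex_weights M \<Longrightarrow> (\<Sum>l<M. w l * g w l) \<le> 0"
    and cont: "\<And>W w l. (\<And>n. W n \<in> simplex_weights M) \<Longrightarrow> w \<in> simplex_weights M \<Longrightarrow>
      (\<And>i. i < M \<Longrightarrow> (\<lambda>n. W n i) \<longlonglongrightarrow> w i) \<Longrightarrow> l < M \<Longrightarrow> (\<lambda>n. g (W n) l) \<longlonglongrightarrow> g w l"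
  obtains w where "w \<in> simplex_weights M" "\<And>l. l < M \<Longrightarrow> g w l \<le> 0"
proof -
  \<comment> \<open>\<open>c\<close> shares missing mass equally, and the denominator in
    \<open>R\<close> removes excess mass; on the simplex neither acts.\<close>
  define c where "c x = max 0 (1 - (\<Sum>l<M. x l)) / real M" for x
  \<comment> \<open>\<open>R\<close> retracts the cube onto the simplex, and \<open>T\<close> is Nash's improvement map on the simplex.\<close>
  define R where "R x = (\<lambda>l. (x l + c x) / max 1 (\<Sum>l<M. x l))" for x
  define T where "T w = (\<lambda>l. (w l + max 0 (g w l)) / (1 + (\<Sum>l<M. max 0 (g w l))))" for w
  have R: "R x \<in> simplex_weights M" if "\<And>i. i < M \<Longrightarrow> x i \<in> {0..1}" for x
  proof -
    have "(\<Sum>l<M. x l + c x) = (\<Sum>l<M. x l) + max 0 (1 - (\<Sum>l<M. x l))"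
      using \<open>0 < M\<close> by (simp add: sum.distrib c_def)
    also have "\<dots> = max 1 (\<Sum>l<M. x l)" by simp
    finally have "(\<Sum>l<M. R x l) = 1"
      unfolding R_def by (simp flip: sum_divide_distrib)
    moreover have "0 \<le> R x l" if "l < M" for l
      using \<open>\<And>i. i < M \<Longrightarrow> x i \<in> {0..1}\<close>[OF that] by (auto simp: R_def c_def)
    ultimately show ?thesis by (simp add: simplex_weights_def)
  qed
  have pos: "0 < 1 + (\<Sum>l<M. max 0 (g w l))" for w
    by (simp add: add_pos_nonneg sum_nonneg)
  have T: "T w \<in> simplex_weights M" if "w \<in> simplex_weights M" for w
  proof -
    have "(\<Sum>l<M. T w l) = 1"
      using that pos[of w] unfolding T_def
      by (simp add: sum.distrib simplex_weights_def flip: sum_divide_distrib)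
    moreover have "0 \<le> T w l" if "l < M" for l
      using pos[of w] that \<open>w \<in> simplex_weights M\<close> unfolding T_def simplex_weights_def
      by (intro divide_nonneg_pos) auto
    ultimately show ?thesis by (simp add: simplex_weights_def)
  qed
  have le1: "w l \<in> {0..1}" if "w \<in> simplex_weights M" "l < M" for w l
  proof -
    have "w l \<le> (\<Sum>l<M. w l)"
      using that by (intro member_le_sum) (auto simp: simplex_weights_def)
    then show ?thesis using that by (auto simp: simplex_weights_def)
  qed
  obtain x where x: "\<And>i. i < M \<Longrightarrow> x i \<in> {0..1}" "\<And>i. i < M \<Longrightarrow> T (R x) i = x i"
  proof (rule brouwer_nat_cube[of M "\<lambda>x. T (R x)"])
    fix X :: "nat \<Rightarrow> nat \<Rightarrow> real" and x l
    assume X: "\<And>n i. i < M \<Longrightarrow> X n i \<in> {0..1}" "\<And>i. i < M \<Longrightarrow> x i \<in> {0..1}"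
      "\<And>i. i < M \<Longrightarrow> (\<lambda>n. X n i) \<longlonglongrightarrow> x i" and l: "l < M"
    have RX: "(\<lambda>n. R (X n) i) \<longlonglongrightarrow> R x i" if "i < M" for i
      unfolding R_def c_def using that X \<open>0 < M\<close> by (intro tendsto_intros) auto
    then have "(\<lambda>n. g (R (X n)) i) \<longlonglongrightarrow> g (R x) i" if "i < M" for i
      using R X that by (intro cont) auto
    with RX l show "(\<lambda>n. T (R (X n)) l) \<longlonglongrightarrow> T (R x) l"
      unfolding T_def by (intro tendsto_intros) (use pos[of "R x"] in auto)
  qed (use le1 R T in auto)
  \<comment> \<open>\<open>x\<close> agrees with a value of \<open>T\<close> in the first
    \<open>M\<close> coordinates, so it already lies in the simplex and \<open>R\<close> fixes
    it.\<close>
  have "T (R x) \<in> simplex_weights M" using x R T by blast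
  moreover have "(\<Sum>l<M. T (R x) l) = (\<Sum>l<M. x l)" using x by (intro sum.cong) auto
  ultimately have xS: "x \<in> simplex_weights M"
    using x by (auto simp: simplex_weights_def)
  have Rx: "R x = x" using xS by (auto simp: simplex_weights_def R_def c_def)
  define G where "G = (\<Sum>l<M. max 0 (g x l))"
  have fp: "x l * G = max 0 (g x l)" if "l < M" for l
    using x(2)[OF that] pos[of x] unfolding Rx T_def G_def[symmetric]
    by (simp add: divide_simps algebra_simps split: if_splits)
  have "G = 0"
  proof (rule ccontr)
    assume "G \<noteq> 0"
    then have G: "0 < G" unfolding G_def using sum_nonneg[of "{..<M}" "\<lambda>l. max 0 (g x l)"] by force
    have eq: "x l * g x l = (max 0 (g x l))\<^sup>2 / G" if "l < M" for l
      using fp[OF that] G by (auto simp: max_def power2_eq_square field_simps split: if_splits)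
    have "(\<Sum>l<M. (max 0 (g x l))\<^sup>2 / G) \<le> 0"
      using diag[OF xS] eq by simp
    then have "(\<Sum>l<M. (max 0 (g x l))\<^sup>2 / G) = 0"
      using G by (intro antisym sum_nonneg) auto
    then have "\<forall>l<M. (max 0 (g x l))\<^sup>2 / G = 0"
      using G by (subst (asm) sum_nonneg_eq_0_iff) auto
    then have "\<forall>l<M. max 0 (g x l) = 0" using G by simp
    then have "G = 0" unfolding G_def by simp
    with G show False by simp
  qed
  then have "g x l \<le> 0" if "l < M" for l using fp[OF that] by (simp add: max_def split: if_splits)
  with xS show ?thesis using that by blast
qed

text \<open>
  The convergence relation \<open>L\<close> replaces a topology on \<open>X\<close>.
\<close>

lemma seq_compact_finite_net:
  fixes \<psi> :: "'a \<Rightarrow> 'a \<Rightarrow> real" and L :: "(nat \<Rightarrow> 'a) \<Rightarrow> 'a \<Rightarrow> bool"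
  assumes compact: "\<And>\<sigma>. (\<And>n. \<sigma> n \<in> X) \<Longrightarrow> \<exists>r x. strict_mono (r :: nat \<Rightarrow> nat) \<and> x \<in> X \<and> L (\<sigma> \<circ> r) x"
    and subseq: "\<And>\<sigma> x (r :: nat \<Rightarrow> nat). L \<sigma> x \<Longrightarrow> strict_mono (r :: nat \<Rightarrow> nat) \<Longrightarrow> L (\<sigma> \<circ> r) x"
    and cont: "\<And>\<sigma> \<tau> x y. (\<And>n. \<sigma> n \<in> X) \<Longrightarrow> (\<And>n. \<tau> n \<in> X) \<Longrightarrow> x \<in> X \<Longrightarrow> y \<in> X \<Longrightarrow>
      L \<sigma> x \<Longrightarrow> L \<tau> y \<Longrightarrow> (\<lambda>n. \<psi> (\<sigma> n) (\<tau> n)) \<longlonglongrightarrow> \<psi> x y"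
    and "0 < \<epsilon>"
  shows "\<exists>D. finite D \<and> D \<subseteq> X \<and> (\<forall>y\<in>X. \<exists>d\<in>D. \<forall>x\<in>X. \<bar>\<psi> x y - \<psi> x d\<bar> < \<epsilon>)"
proof (rule ccontr)
  assume "\<not> ?thesis"
  then have no: "\<exists>y\<in>X. \<forall>d\<in>D. \<exists>x\<in>X. \<not> \<bar>\<psi> x y - \<psi> x d\<bar> < \<epsilon>" if "finite D" "D \<subseteq> X" for D
    using that by simp
  \<comment> \<open>A greedy choice yields a sequence that is \<epsilon>-separated in the
    pseudometric given by the supremum over \<open>x\<close> of
    \<open>\<bar>\<psi> x y - \<psi> x y'\<bar>\<close>.\<close>
  let ?Q = "\<lambda>t n y. y \<in> X \<and> (\<forall>m < (n::nat). \<exists>x\<in>X. \<not> \<bar>\<psi> x y - \<psi> x (t m)\<bar> < \<epsilon>)"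
  have "\<exists>t. \<forall>n::nat. ?Q t n (t n)"
  proof (rule dependent_wellorder_choice)
    fix n t assume "\<And>y. y < n \<Longrightarrow> ?Q t y (t y)"
    then show "\<exists>r. ?Q t n r"
      using no[of "t ` {0..<n}"] by fastforce
  qed simp
  then obtain t where "\<forall>n::nat. ?Q t n (t n)" ..
  then have t: "\<And>n. t n \<in> X"
    and sep: "\<And>n m. m < n \<Longrightarrow> \<exists>x\<in>X. \<not> \<bar>\<psi> x (t n) - \<psi> x (t m)\<bar> < \<epsilon>" by simp_all
  obtain r y where r: "strict_mono (r :: nat \<Rightarrow> nat)" and y: "y \<in> X" "L (t \<circ> r) y"
    using compact[of t] t by auto
  \<comment> \<open>Consecutive terms of the convergent subsequence are separated by witnesses
    \<open>\<xi> n\<close>. Along a further subsequence on which the witnesses converge too, both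
    neighbours tend to \<open>y\<close>, so joint continuity makes the gap vanish.\<close>
  have "\<exists>x\<in>X. \<not> \<bar>\<psi> x (t (r (Suc n))) - \<psi> x (t (r n))\<bar> < \<epsilon>" for n
    using sep r by (simp add: strict_mono_Suc_iff)
  then obtain \<xi> where \<xi>: "\<And>n. \<xi> n \<in> X"
    and far: "\<And>n. \<not> \<bar>\<psi> (\<xi> n) (t (r (Suc n))) - \<psi> (\<xi> n) (t (r n))\<bar> < \<epsilon>" by metis
  obtain s x where s: "strict_mono (s :: nat \<Rightarrow> nat)" and x: "x \<in> X" "L (\<xi> \<circ> s) x"
    using compact[of \<xi>] \<xi> by auto
  have Suc_s: "strict_mono (Suc \<circ> s)"
    using s by (simp add: strict_mono_Suc_iff)
  have 1: "(\<lambda>n. \<psi> ((\<xi> \<circ> s) n) (((t \<circ> r) \<circ> s) n)) \<longlonglongrightarrow> \<psi> x y"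
    by (rule cont[OF _ _ x(1) y(1) x(2) subseq[OF y(2) s]]) (simp_all add: \<xi> t)
  have 2: "(\<lambda>n. \<psi> ((\<xi> \<circ> s) n) (((t \<circ> r) \<circ> (Suc \<circ> s)) n)) \<longlonglongrightarrow> \<psi> x y"
    by (rule cont[OF _ _ x(1) y(1) x(2) subseq[OF y(2) Suc_s]]) (simp_all add: \<xi> t)
  from tendsto_rabs[OF tendsto_diff[OF 2 1]]
  have "\<epsilon> \<le> \<bar>\<psi> x y - \<psi> x y\<bar>"
    by (rule LIMSEQ_le_const) (use far in \<open>simp add: not_less\<close>)
  with \<open>0 < \<epsilon>\<close> show False by simp
qed

text \<open>\<open>mix\<close> is an abstract operation, affine only as seen by the second argument
  of \<psi>. For the first argument \<open>mix_cont\<close> demands continuity of the values of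
  \<psi> in the weights, which avoids convergence of the mixtures in the sense of
  \<open>L\<close>.\<close>

lemma ky_fan_seq_compact:
  fixes \<psi> :: "'a \<Rightarrow> 'a \<Rightarrow> real" and L :: "(nat \<Rightarrow> 'a) \<Rightarrow> 'a \<Rightarrow> bool"
  assumes "X \<noteq> {}"
    and compact: "\<And>\<sigma>. (\<And>n. \<sigma> n \<in> X) \<Longrightarrow> \<exists>r x. strict_mono (r :: nat \<Rightarrow> nat) \<and> x \<in> X \<and> L (\<sigma> \<circ> r) x"
    and subseq: "\<And>\<sigma> x (r :: nat \<Rightarrow> nat). L \<sigma> x \<Longrightarrow> strict_mono (r :: nat \<Rightarrow> nat) \<Longrightarrow> L (\<sigma> \<circ> r) x"
    and const: "\<And>x. x \<in> X \<Longrightarrow> L (\<lambda>_. x) x"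
    and cont: "\<And>\<sigma> \<tau> x y. (\<And>n. \<sigma> n \<in> X) \<Longrightarrow> (\<And>n. \<tau> n \<in> X) \<Longrightarrow> x \<in> X \<Longrightarrow> y \<in> X \<Longrightarrow>
      L \<sigma> x \<Longrightarrow> L \<tau> y \<Longrightarrow> (\<lambda>n. \<psi> (\<sigma> n) (\<tau> n)) \<longlonglongrightarrow> \<psi> x y"
    and diag: "\<And>x. x \<in> X \<Longrightarrow> \<psi> x x \<le> 0"
    and mix: "\<And>w M q. w \<in> simplex_weights M \<Longrightarrow> (\<And>l. l < M \<Longrightarrow> q l \<in> X) \<Longrightarrow>
      mix M w q \<in> X \<and> (\<forall>x\<in>X. \<psi> x (mix M w q) = (\<Sum>l<M. w l * \<psi> x (q l)))"
    and mix_cont: "\<And>W w M q y. (\<And>n. W n \<in> simplex_weights M) \<Longrightarrow> w \<in> simplex_weights M \<Longrightarrow>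
      (\<And>l. l < M \<Longrightarrow> q l \<in> X) \<Longrightarrow> y \<in> X \<Longrightarrow>
      (\<And>i. i < M \<Longrightarrow> (\<lambda>n. W n i) \<longlonglongrightarrow> w i) \<Longrightarrow>
      (\<lambda>n. \<psi> (mix M (W n) q) y) \<longlonglongrightarrow> \<psi> (mix M w q) y"
  shows "\<exists>x\<in>X. \<forall>y\<in>X. \<psi> x y \<le> 0"
proof -
  \<comment> \<open>A point that is good for a finite net is good for all of \<open>X\<close> up to
    \<epsilon>; the points for \<epsilon> = 1 / (n + 1) then accumulate at a solution.\<close>
  have "\<exists>x\<in>X. \<forall>y\<in>X. \<psi> x y \<le> \<epsilon>" if "0 < \<epsilon>" for \<epsilon>
  proof -
    have "\<exists>D. finite D \<and> D \<subseteq> X \<and> (\<forall>y\<in>X. \<exists>d\<in>D. \<forall>x\<in>X. \<bar>\<psi> x y - \<psi> x d\<bar> < \<epsilon>)"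
      by (rule seq_compact_finite_net[where L = L, OF compact subseq cont \<open>0 < \<epsilon>\<close>])
    then obtain D where D: "finite D" "D \<subseteq> X"
      "\<And>y. y \<in> X \<Longrightarrow> \<exists>d\<in>D. \<forall>x\<in>X. \<bar>\<psi> x y - \<psi> x d\<bar> < \<epsilon>" by auto
    define M where "M = card D"
    obtain q where q: "bij_betw q {..<M} D"
      using ex_bij_betw_nat_finite[OF D(1)] unfolding M_def atLeast0LessThan by blast
    have qX: "q l \<in> X" if "l < M" for l using q D(2) that by (auto simp: bij_betw_def)
    have "D \<noteq> {}" using D(3) \<open>X \<noteq> {}\<close> by fastforce
    then have "0 < M" using D(1) by (simp add: M_def card_gt_0_iff)
    obtain w where w: "w \<in> simplex_weights M" "\<And>l. l < M \<Longrightarrow> \<psi> (mix M w q) (q l) \<le> 0"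
    proof (rule ky_fan_finite[of M "\<lambda>w l. \<psi> (mix M w q) (q l)"])
      fix w assume w: "w \<in> simplex_weights M"
      have "mix M w q \<in> X" using mix w qX by blast
      \<comment> \<open>By affinity the weighted sum is the diagonal value of \<psi> at the
        mixture.\<close>
      then show "(\<Sum>l<M. w l * \<psi> (mix M w q) (q l)) \<le> 0"
        using mix[OF w qX] diag[of "mix M w q"] by simp
    qed (use mix_cont qX \<open>0 < M\<close> in auto)
    have x: "mix M w q \<in> X" using mix w qX by blast
    have "\<psi> (mix M w q) y \<le> \<epsilon>" if y: "y \<in> X" for y
    proof -
      obtain d where "d \<in> D" "\<bar>\<psi> (mix M w q) y - \<psi> (mix M w q) d\<bar> < \<epsilon>"
        using D(3)[OF y] x by blast
      moreover obtain l where "l < M" "d = q l" using q \<open>d \<in> D\<close> by (auto simp: bij_betw_def)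
      ultimately show ?thesis using w(2) by fastforce
    qed
    with x show ?thesis by blast
  qed
  then have "\<forall>n. \<exists>x\<in>X. \<forall>y\<in>X. \<psi> x y \<le> 1 / real (Suc n)" by simp
  then obtain \<sigma> where \<sigma>: "\<And>n. \<sigma> n \<in> X" "\<And>n y. y \<in> X \<Longrightarrow> \<psi> (\<sigma> n) y \<le> 1 / real (Suc n)" by metis
  obtain r x where r: "strict_mono r" and x: "x \<in> X" "L (\<sigma> \<circ> r) x" using compact[of \<sigma>] \<sigma>(1) by auto
  have "\<psi> x y \<le> 0" if y: "y \<in> X" for y
  proof (rule LIMSEQ_le)
    show "(\<lambda>n. \<psi> ((\<sigma> \<circ> r) n) y) \<longlonglongrightarrow> \<psi> x y"
      using \<sigma> x y const by (intro cont[where \<tau> = "\<lambda>_. y"]) (simp_all add: comp_def)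
    show "(\<lambda>n. 1 / real (Suc (r n))) \<longlonglongrightarrow> 0"
      using LIMSEQ_subseq_LIMSEQ[OF LIMSEQ_inverse_real_of_nat r]
      by (simp add: comp_def inverse_eq_divide)
    show "\<exists>N. \<forall>n\<ge>N. \<psi> ((\<sigma> \<circ> r) n) y \<le> 1 / real (Suc (r n))"
      using \<sigma>(2)[OF y] by auto
  qed
  with x(1) show ?thesis by blast
qed

section \<open>A space-filling curve\<close>

text \<open>
  Schoenberg's space-filling curve, with a function of the cosine in place of his piecewise linear
  one. It maps the line continuously onto a square and has a Borel right inverse, which reduces
  compactness of the probability measures on a square to Helly's theorem on the line.
\<close>

definition schoenberg_digit :: "real \<Rightarrow> real" where
  "schoenberg_digit t = max 0 (min 1 (1 / 2 - cos (pi * t)))"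

text \<open>On 0-1 sequences this parametrizes the Cantor set, whose ternary digits are 0 and
  2.\<close>

definition ternary :: "(nat \<Rightarrow> real) \<Rightarrow> real" where
  "ternary d = (\<Sum>j. 2 * d j / 3 ^ Suc j)"

definition schoenberg :: "real \<Rightarrow> real \<times> real" where
  "schoenberg t = (\<Sum>i. schoenberg_digit (3 ^ (2 * i) * t) / 2 ^ i,
                   \<Sum>i. schoenberg_digit (3 ^ (2 * i + 1) * t) / 2 ^ i)"

text \<open>Bit 0 is the integer part, which gives 1 a finite expansion. Accordingly the series in
  \<open>schoenberg\<close> start with weight 1, and the curve stays in the square over
  [0,2].\<close>

definition bit_of :: "nat \<Rightarrow> real \<Rightarrow> real" where
  "bit_of i x = of_int (\<lfloor>2 ^ i * x\<rfloor> mod 2)"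

text \<open>Interleaving the two binary expansions gives a map that is discontinuous but Borel,
  being built from floors and a series.\<close>

definition schoenberg_inv :: "real \<times> real \<Rightarrow> real" where
  "schoenberg_inv z =
     ternary (\<lambda>j. if even j then bit_of (j div 2) (fst z) else bit_of (j div 2) (snd z))"

lemma schoenberg_digit_bounds: "0 \<le> schoenberg_digit t" "schoenberg_digit t \<le> 1"
  by (auto simp: schoenberg_digit_def)

lemma schoenberg_digit_periodic: "schoenberg_digit (t + 2 * of_int m) = schoenberg_digit t"
proof -
  have "cos (pi * (t + 2 * of_int m)) = cos (pi * t)"
  proof -
    have "pi * (t + 2 * of_int m) = pi * t + 2 * pi * of_int m" by (simp add: algebra_simps)
    then show ?thesis by (simp add: cos_add cos_int_2pin sin_int_2pin)
  qed
  then show ?thesis by (simp add: schoenberg_digit_def)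
qed

text \<open>For t in the first third of [0,1], cos (pi t) is at least 1/2, and in the last third it
  is at most -1/2, so the clamp in \<open>schoenberg_digit\<close> is constant on each of
  them.\<close>

lemma schoenberg_digit_eq:
  assumes "d = 0 \<or> d = 1" "2 * d / 3 \<le> t" "t \<le> 2 * d / 3 + 1 / 3"
  shows "schoenberg_digit t = d"
  using assms(1)
proof
  assume d: "d = 0"
  have "cos (pi / 3) \<le> cos (pi * t)"
    using assms d by (intro cos_monotone_0_pi_le) (auto simp: field_simps)
  then show ?thesis using d by (simp add: schoenberg_digit_def cos_60)
next
  assume d: "d = 1"
  have "cos (pi * t) \<le> cos (pi * (2 / 3))"
    using assms d by (intro cos_monotone_0_pi_le) (auto simp: field_simps)
  also have "\<dots> = cos (2 * (pi / 3))" by (simp add: field_simps)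
  also have "\<dots> = - 1 / 2" unfolding cos_double_cos by (simp add: cos_60 power2_eq_square)
  finally show ?thesis using d by (simp add: schoenberg_digit_def)
qed

lemma summable_ternary:
  assumes "\<And>j. d j = 0 \<or> d j = (1::real)"
  shows "summable (\<lambda>j. 2 * d j / 3 ^ Suc j)"
proof (rule summable_comparison_test')
  show "summable (\<lambda>j. (2 / 3) * (1 / 3) ^ j :: real)"
    by (intro summable_mult summable_geometric) auto
  show "norm (2 * d n / 3 ^ Suc n) \<le> (2 / 3) * (1 / 3) ^ n" for n
    using assms[of n] by (auto simp: power_divide)
qed

lemma ternary_bounds:
  assumes "\<And>j. d j = 0 \<or> d j = (1::real)"
  shows "0 \<le> ternary d" "ternary d \<le> 1"
proof -
  show "0 \<le> ternary d"
    unfolding ternary_def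
  proof (rule suminf_nonneg[OF summable_ternary[OF assms]])
    show "0 \<le> 2 * d n / 3 ^ Suc n" for n using assms[of n] by auto
  qed
  have "ternary d \<le> (\<Sum>j. (2 / 3) * (1 / 3) ^ j)"
    unfolding ternary_def
  proof (rule suminf_le[OF _ summable_ternary[OF assms]])
    show "summable (\<lambda>j. (2 / 3) * (1 / 3) ^ j :: real)"
      by (intro summable_mult summable_geometric) auto
    show "2 * d n / 3 ^ Suc n \<le> (2 / 3) * (1 / 3) ^ n" for n
      using assms[of n] by (auto simp: power_divide)
  qed
  also have "\<dots> = 1"
    by (subst suminf_mult) (auto simp: suminf_geometric intro!: summable_geometric)
  finally show "ternary d \<le> 1" .
qed

lemma ternary_shift:
  assumes "\<And>j. d j = 0 \<or> d j = (1::real)"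
  shows "3 * ternary d = 2 * d 0 + ternary (\<lambda>j. d (Suc j))"
proof -
  have "ternary d = (\<Sum>j. 2 * d (Suc j) / 3 ^ Suc (Suc j)) + 2 * d 0 / 3"
    unfolding ternary_def by (subst suminf_split_head[OF summable_ternary[OF assms]]) simp
  also have "(\<Sum>j. 2 * d (Suc j) / 3 ^ Suc (Suc j)) = (\<Sum>j. 2 * d (Suc j) / 3 ^ Suc j / 3)"
    by (simp add: field_simps)
  also have "\<dots> = ternary (\<lambda>j. d (Suc j)) / 3"
    unfolding ternary_def using assms by (intro suminf_divide summable_ternary) auto
  finally show ?thesis by simp
qed

text \<open>Multiplication by 3 shifts the expansion and splits off the even integer
  \<open>2 * d 0\<close>, which the period 2 ignores. After \<open>n\<close> shifts the leading
  digit decides in which outer third the argument lies.\<close>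

lemma schoenberg_digit_ternary:
  assumes "\<And>j. d j = 0 \<or> d j = (1::real)"
  shows "schoenberg_digit (3 ^ n * ternary d) = d n"
  using assms
proof (induction n arbitrary: d)
  case 0
  have "3 * ternary d = 2 * d 0 + ternary (\<lambda>j. d (Suc j))"
    by (rule ternary_shift) (rule 0)
  then show ?case
    using ternary_bounds[of "\<lambda>j. d (Suc j)"] 0 by (intro schoenberg_digit_eq) auto
next
  case (Suc n)
  have "d 0 \<in> \<int>" using Suc.prems[of 0] by auto
  then obtain m where m: "d 0 = of_int m" by (auto elim: Ints_cases)
  have "3 ^ Suc n * ternary d = 3 ^ n * (3 * ternary d)" by simp
  also have "\<dots> = 3 ^ n * ternary (\<lambda>j. d (Suc j)) + 2 * of_int (3 ^ n * m)"
    by (subst ternary_shift[OF Suc.prems]) (simp add: m algebra_simps)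
  finally show ?case
    using Suc.IH[of "\<lambda>j. d (Suc j)"] Suc.prems by (simp only: schoenberg_digit_periodic)
qed

lemma bit_of_cases: "bit_of i x = 0 \<or> bit_of i x = 1"
proof -
  have "k mod 2 = 0 \<or> k mod 2 = 1" for k :: int by presburger
  from this[of "\<lfloor>2 ^ i * x\<rfloor>"] show ?thesis by (auto simp: bit_of_def)
qed

lemma borel_measurable_bit_of [measurable]: "bit_of i \<in> borel_measurable borel"
proof -
  have "(\<lambda>x :: real. \<lfloor>2 ^ i * x\<rfloor>) \<in> measurable borel (count_space UNIV)" for i
    by measurable
  from measurable_compose[OF this, of "\<lambda>k. real_of_int (k mod 2)"]
  show ?thesis unfolding bit_of_def by simp
qed

text \<open>The partial sums are the dyadic truncations floor(2^n x) / 2^n, since each floor is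
  twice the preceding one plus a bit.\<close>

lemma bits_sums:
  assumes "0 \<le> x" "x \<le> 1"
  shows "(\<lambda>i. bit_of i x / 2 ^ i) sums x"
proof -
  have partial: "(\<Sum>i<Suc n. bit_of i x / 2 ^ i) = of_int \<lfloor>2 ^ n * x\<rfloor> / 2 ^ n" for n
  proof (induction n)
    case 0
    have "\<lfloor>x\<rfloor> = 0 \<or> \<lfloor>x\<rfloor> = 1" using assms by (auto simp: floor_eq_iff)
    then show ?case by (auto simp: bit_of_def)
  next
    case (Suc n)
    have "\<lfloor>2 ^ Suc n * x\<rfloor> div 2 = \<lfloor>2 ^ Suc n * x / 2\<rfloor>"
      using floor_divide_real_eq_div[of 2 "2 ^ Suc n * x"] by simp
    then have "\<lfloor>2 ^ Suc n * x\<rfloor> div 2 = \<lfloor>2 ^ n * x\<rfloor>" by simp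
    then have "\<lfloor>2 ^ Suc n * x\<rfloor> = 2 * \<lfloor>2 ^ n * x\<rfloor> + \<lfloor>2 ^ Suc n * x\<rfloor> mod 2" by presburger
    then have "real_of_int \<lfloor>2 ^ Suc n * x\<rfloor> = 2 * of_int \<lfloor>2 ^ n * x\<rfloor> + bit_of (Suc n) x"
      unfolding bit_of_def by linarith
    with Suc.IH show ?case by (simp add: field_simps)
  qed
  have "(\<lambda>n. of_int \<lfloor>2 ^ n * x\<rfloor> / 2 ^ n) \<longlonglongrightarrow> x"
  proof (rule real_tendsto_sandwich)
    have "x - (1 / 2) ^ n = (2 ^ n * x - 1) / 2 ^ n" for n
      by (simp add: power_divide diff_divide_distrib)
    then show "\<forall>\<^sub>F n in sequentially. x - (1 / 2) ^ n \<le> of_int \<lfloor>2 ^ n * x\<rfloor> / 2 ^ n"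
      using real_of_int_floor_ge_diff_one by (auto intro!: always_eventually divide_right_mono)
    have "x = 2 ^ n * x / 2 ^ n" for n :: nat by simp
    then show "\<forall>\<^sub>F n in sequentially. of_int \<lfloor>2 ^ n * x\<rfloor> / 2 ^ n \<le> x"
      by (metis (mono_tags, lifting) always_eventually divide_right_mono of_int_floor_le zero_le_numeral zero_le_power)
    have "(\<lambda>n. (1 / 2) ^ n :: real) \<longlonglongrightarrow> 0" by (intro LIMSEQ_power_zero) auto
    from tendsto_diff[OF tendsto_const this] show "(\<lambda>n. x - (1 / 2) ^ n) \<longlonglongrightarrow> x" by simp
  qed simp
  then have "(\<lambda>n. \<Sum>i<Suc n. bit_of i x / 2 ^ i) \<longlonglongrightarrow> x" unfolding partial .
  then show ?thesis unfolding sums_def by (rule LIMSEQ_imp_Suc)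
qed

lemma schoenberg_schoenberg_inv:
  assumes "z \<in> {0..1} \<times> {0..1}"
  shows "schoenberg (schoenberg_inv z) = z"
proof -
  define d where "d = (\<lambda>j. if even j then bit_of (j div 2) (fst z) else bit_of (j div 2) (snd z))"
  have d: "d j = 0 \<or> d j = 1" for j
    using bit_of_cases by (auto simp: d_def)
  have "schoenberg_digit (3 ^ (2 * i) * schoenberg_inv z) = bit_of i (fst z)"
       "schoenberg_digit (3 ^ (2 * i + 1) * schoenberg_inv z) = bit_of i (snd z)" for i
    unfolding schoenberg_inv_def d_def[symmetric] schoenberg_digit_ternary[OF d]
    by (simp_all add: d_def)
  then show ?thesis
    unfolding schoenberg_def using assms bits_sums[of "fst z"] bits_sums[of "snd z"]
    by (auto simp: sums_iff prod_eq_iff)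
qed

lemma schoenberg_inv_bounds: "schoenberg_inv z \<in> {0..1}"
  unfolding schoenberg_inv_def
  using ternary_bounds[of "\<lambda>j. if even j then bit_of (j div 2) (fst z) else bit_of (j div 2) (snd z)"]
    bit_of_cases by auto

lemma borel_measurable_schoenberg_inv [measurable]:
  "schoenberg_inv \<in> borel_measurable (borel \<Otimes>\<^sub>M borel)"
  unfolding schoenberg_inv_def[abs_def] ternary_def by measurable

lemma continuous_on_schoenberg: "continuous_on UNIV schoenberg"
proof -
  have cont: "continuous_on UNIV (\<lambda>t. \<Sum>i. schoenberg_digit (c i * t) / 2 ^ i)" for c :: "nat \<Rightarrow> real"
  proof (rule uniform_limit_theorem)
    show "uniform_limit UNIV (\<lambda>n t. \<Sum>i<n. schoenberg_digit (c i * t) / 2 ^ i)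
        (\<lambda>t. \<Sum>i. schoenberg_digit (c i * t) / 2 ^ i) sequentially"
    proof (rule Weierstrass_m_test)
      show "summable (\<lambda>i. (1 / 2) ^ i :: real)" by (intro summable_geometric) auto
      show "norm (schoenberg_digit (c n * t) / 2 ^ n) \<le> (1 / 2) ^ n" for n t
        using schoenberg_digit_bounds[of "c n * t"] by (simp add: power_divide divide_right_mono)
    qed
    show "\<forall>\<^sub>F n in sequentially. continuous_on UNIV (\<lambda>t. \<Sum>i<n. schoenberg_digit (c i * t) / 2 ^ i)"
      unfolding schoenberg_digit_def by (intro always_eventually allI continuous_intros) auto
  qed simp
  show ?thesis
    unfolding schoenberg_def by (intro continuous_on_Pair cont)
qed

section \<open>Compactness of the strategy sets\<close>

abbreviation pair_I :: "real \<Rightarrow> (real \<times> real) measure" where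
  "pair_I v \<equiv> borel_I v \<Otimes>\<^sub>M borel_I v"

lemma space_borel_I [simp]: "space (borel_I v) = {v..1}"
  by (simp add: borel_I_def space_restrict_space)

lemma space_pair_I: "space (pair_I v) = {v..1} \<times> {v..1}"
  by (simp add: space_pair_measure)

lemma measurable_borel_I_iff:
  "f \<in> measurable M (borel_I v) \<longleftrightarrow> f \<in> borel_measurable M \<and> f \<in> space M \<rightarrow> {v..1}"
  unfolding borel_I_def by (subst measurable_restrict_space2_iff) auto

lemma measurable_borel_I_ident [measurable]: "(\<lambda>x. x) \<in> borel_measurable (borel_I v)"
  using measurable_borel_I_iff[of "\<lambda>x. x" "borel_I v" v] by simp

lemma measurable_pair_I_fst [measurable]: "fst \<in> borel_measurable (pair_I v)"
  by (rule measurable_compose[OF measurable_fst measurable_borel_I_ident])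

lemma measurable_pair_I_snd [measurable]: "snd \<in> borel_measurable (pair_I v)"
  by (rule measurable_compose[OF measurable_snd measurable_borel_I_ident])

lemma measurable_pair_I_iff:
  "f \<in> measurable M (pair_I v) \<longleftrightarrow>
     (\<lambda>x. fst (f x)) \<in> borel_measurable M \<and> (\<lambda>x. snd (f x)) \<in> borel_measurable M \<and>
     f \<in> space M \<rightarrow> {v..1} \<times> {v..1}"
  unfolding measurable_pair_iff measurable_borel_I_iff comp_def
  by (auto simp: Pi_iff mem_Times_iff)

lemma borel_measurable_continuous_on_I:
  "continuous_on {v..1} h \<Longrightarrow> h \<in> borel_measurable (borel_I v)"
  unfolding borel_I_def by (rule borel_measurable_continuous_on_restrict)

text \<open>
  Convergence in distribution on the square, in the form that Skorohod's theorem provides. The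
  underlying space may depend on the sequence.
\<close>

definition skorohod_limit ::
  "real \<Rightarrow> (nat \<Rightarrow> (real \<times> real) measure) \<Rightarrow> (real \<times> real) measure \<Rightarrow> bool" where
  "skorohod_limit v \<sigma> p \<longleftrightarrow> (\<exists>(\<Omega> :: real measure) Y X. prob_space \<Omega> \<and>
     (\<forall>n. Y n \<in> measurable \<Omega> (pair_I v)) \<and> (\<forall>n. distr \<Omega> (pair_I v) (Y n) = \<sigma> n) \<and>
     X \<in> measurable \<Omega> (pair_I v) \<and> distr \<Omega> (pair_I v) X = p \<and>
     (\<forall>\<omega>\<in>space \<Omega>. (\<lambda>n. Y n \<omega>) \<longlonglongrightarrow> X \<omega>))"

lemma skorohod_limit_subseq:
  assumes "skorohod_limit v \<sigma> p" "strict_mono r"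
  shows "skorohod_limit v (\<sigma> \<circ> r) p"
proof -
  obtain \<Omega> :: "real measure" and Y X where *: "prob_space \<Omega>"
    "\<forall>n. Y n \<in> measurable \<Omega> (pair_I v)" "\<forall>n. distr \<Omega> (pair_I v) (Y n) = \<sigma> n"
    "X \<in> measurable \<Omega> (pair_I v)" "distr \<Omega> (pair_I v) X = p"
    and lim: "\<forall>\<omega>\<in>space \<Omega>. (\<lambda>n. Y n \<omega>) \<longlonglongrightarrow> X \<omega>"
    using assms(1) unfolding skorohod_limit_def by blast
  have "\<forall>\<omega>\<in>space \<Omega>. (\<lambda>n. Y (r n) \<omega>) \<longlonglongrightarrow> X \<omega>"
  proof
    fix \<omega> assume "\<omega> \<in> space \<Omega>"
    with lim LIMSEQ_subseq_LIMSEQ[OF _ assms(2), of "\<lambda>n. Y n \<omega>"]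
    show "(\<lambda>n. Y (r n) \<omega>) \<longlonglongrightarrow> X \<omega>" by (simp add: comp_def)
  qed
  with * show ?thesis
    unfolding skorohod_limit_def
    by (intro exI[of _ \<Omega>] exI[of _ "\<lambda>n. Y (r n)"] exI[of _ X]) auto
qed

text \<open>Clamping puts the curve into the square of values and messages and fixes the points
  already there, so \<open>schoenberg_inv\<close> stays a right inverse when
  \<open>0 \<le> v\<close>.\<close>

definition schoenberg_I :: "real \<Rightarrow> real \<Rightarrow> real \<times> real" where
  "schoenberg_I v t = (max v (min 1 (fst (schoenberg t))), max v (min 1 (snd (schoenberg t))))"

lemma continuous_on_schoenberg_I: "continuous_on UNIV (schoenberg_I v)"
  unfolding schoenberg_I_def
  by (intro continuous_intros continuous_on_schoenberg)

lemma measurable_schoenberg_I: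
  assumes "v \<le> 1"
  shows "schoenberg_I v \<in> measurable borel (pair_I v)"
proof -
  have "(\<lambda>t. fst (schoenberg_I v t)) \<in> borel_measurable borel"
    "(\<lambda>t. snd (schoenberg_I v t)) \<in> borel_measurable borel"
    by (intro borel_measurable_continuous_onI continuous_intros continuous_on_schoenberg_I)+
  then show ?thesis
    unfolding measurable_pair_I_iff using assms by (auto simp: schoenberg_I_def)
qed

lemma schoenberg_I_inv:
  assumes "0 \<le> v" "z \<in> {v..1} \<times> {v..1}"
  shows "schoenberg_I v (schoenberg_inv z) = z"
  using assms schoenberg_schoenberg_inv[of z] by (auto simp: schoenberg_I_def)

lemma measurable_schoenberg_inv: "schoenberg_inv \<in> borel_measurable (pair_I v)"
proof -
  have "(\<lambda>z. schoenberg_inv (fst z, snd z)) \<in> borel_measurable (pair_I v)" by measurable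
  then show ?thesis by simp
qed

text \<open>Every law on the square is thus the image of a law on the line under a continuous map,
  and the line is where the theorems of Helly and Skorohod apply.\<close>

lemma distr_schoenberg_I:
  assumes "0 \<le> v" "v \<le> 1" "sets p = sets (pair_I v)"
  shows "distr (distr p borel schoenberg_inv) (pair_I v) (schoenberg_I v) = p"
proof -
  have [measurable]: "schoenberg_inv \<in> borel_measurable p"
    using measurable_schoenberg_inv measurable_cong_sets[OF assms(3) refl] by blast
  have sp: "space p = {v..1} \<times> {v..1}"
    using sets_eq_imp_space_eq[OF assms(3)] by (simp add: space_pair_I)
  have "distr (distr p borel schoenberg_inv) (pair_I v) (schoenberg_I v) =
      distr p (pair_I v) (schoenberg_I v \<circ> schoenberg_inv)"
    by (intro distr_distr measurable_schoenberg_I assms) measurable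
  also have "\<dots> = distr p p (\<lambda>x. x)"
    using assms sp by (intro distr_cong) (auto simp: schoenberg_I_inv)
  also have "\<dots> = p" by simp
  finally show ?thesis .
qed

text \<open>The definition asks for an underlying space of reals, so the square with the identity
  map is replaced by the line with the curve as random variable.\<close>

lemma skorohod_limit_const:
  assumes "0 \<le> v" "v \<le> 1" "prob_space p" "sets p = sets (pair_I v)"
  shows "skorohod_limit v (\<lambda>_. p) p"
proof -
  have "schoenberg_inv \<in> borel_measurable p"
    using measurable_schoenberg_inv measurable_cong_sets[OF assms(4) refl] by blast
  then have "prob_space (distr p borel schoenberg_inv)"
    by (rule prob_space.prob_space_distr[OF assms(3)])
  moreover have "schoenberg_I v \<in> measurable (distr p borel schoenberg_inv) (pair_I v)"
    using measurable_schoenberg_I[OF assms(2)] by simp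
  ultimately show ?thesis
    unfolding skorohod_limit_def using distr_schoenberg_I[OF assms(1,2,4)]
    by (intro exI[of _ "distr p borel schoenberg_inv"] exI[of _ "\<lambda>_. schoenberg_I v"]
      exI[of _ "schoenberg_I v"]) auto
qed

text \<open>The laws carried to the line sit on [0,1], so they are tight and a subsequence converges
  weakly. Skorohod's theorem makes the convergence pointwise, and the continuous curve carries it
  back; the inverse, which is only Borel, is never applied to a limit.\<close>

lemma skorohod_limit_compact:
  fixes \<sigma> :: "nat \<Rightarrow> (real \<times> real) measure"
  assumes v: "0 \<le> v" "v \<le> 1"
    and \<sigma>: "\<And>n. prob_space (\<sigma> n)" "\<And>n. sets (\<sigma> n) = sets (pair_I v)"
  obtains r p where "strict_mono r" "skorohod_limit v (\<sigma> \<circ> r) p"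
proof -
  define \<mu> where "\<mu> n = distr (\<sigma> n) borel schoenberg_inv" for n
  have inv: "schoenberg_inv \<in> borel_measurable (\<sigma> n)" for n
    using measurable_schoenberg_inv measurable_cong_sets[OF \<sigma>(2) refl] by blast
  have \<mu>: "real_distribution (\<mu> n)" for n
    unfolding \<mu>_def by (rule prob_space.real_distribution_distr[OF \<sigma>(1) inv])
  \<comment> \<open>\<open>tight\<close> uses intervals open on the left, and 0 is not excluded as a
    value, so the left end lies below 0.\<close>
  have "measure (\<mu> n) {-1<..1} = 1" for n
  proof -
    interpret prob_space "\<sigma> n" by (rule \<sigma>)
    have "schoenberg_inv z \<in> {-1<..1}" for z
      using schoenberg_inv_bounds[of z] by auto
    then have "schoenberg_inv -` {-1<..1} \<inter> space (\<sigma> n) = space (\<sigma> n)" by blast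
    then show ?thesis unfolding \<mu>_def by (simp add: measure_distr[OF inv] prob_space)
  qed
  then have "tight \<mu>"
    unfolding tight_def using \<mu> by (intro conjI allI impI exI[of _ "-1"] exI[of _ 1]) simp_all
  then obtain r q where r: "strict_mono r" and q: "real_distribution q"
    and conv: "weak_conv_m (\<mu> \<circ> id \<circ> r) q"
    using tight_imp_convergent_subsubsequence[of \<mu> id] strict_mono_id by blast
  have "real_distribution ((\<mu> \<circ> id \<circ> r) n)" for n using \<mu> by simp
  from Skorohod[OF this q conv]
  obtain \<Omega> :: "real measure" and Y :: "nat \<Rightarrow> real \<Rightarrow> real" and X where \<Omega>: "prob_space \<Omega>"
    and Y': "\<forall>n. Y n \<in> borel_measurable \<Omega>" "\<forall>n. distr \<Omega> borel (Y n) = (\<mu> \<circ> id \<circ> r) n"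
    and X: "X \<in> measurable \<Omega> lborel"
    and lim: "\<forall>x\<in>space \<Omega>. (\<lambda>n. Y n x) \<longlonglongrightarrow> X x"
    by (elim exE conjE)
  note Y = Y'[rule_format]
  have X': "X \<in> borel_measurable \<Omega>" using X by simp
  note S = measurable_schoenberg_I[OF v(2)]
  define p where "p = distr \<Omega> (pair_I v) (\<lambda>x. schoenberg_I v (X x))"
  have "distr \<Omega> (pair_I v) (\<lambda>x. schoenberg_I v (Y n x)) = (\<sigma> \<circ> r) n" for n
  proof -
    have "distr \<Omega> (pair_I v) (\<lambda>x. schoenberg_I v (Y n x)) =
        distr (distr \<Omega> borel (Y n)) (pair_I v) (schoenberg_I v)"
      by (subst distr_distr[OF S Y(1)]) (simp add: comp_def)
    also have "\<dots> = \<sigma> (r n)"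
      unfolding Y(2) by (simp add: \<mu>_def distr_schoenberg_I[OF v \<sigma>(2)])
    finally show ?thesis by simp
  qed
  moreover have "(\<lambda>n. schoenberg_I v (Y n x)) \<longlonglongrightarrow> schoenberg_I v (X x)" if "x \<in> space \<Omega>" for x
    using continuous_on_tendsto_compose[OF continuous_on_schoenberg_I lim[rule_format, OF that]] by simp
  ultimately have "skorohod_limit v (\<sigma> \<circ> r) p"
    unfolding skorohod_limit_def p_def
    using \<Omega> measurable_compose[OF Y(1) S] measurable_compose[OF X' S]
    by (intro exI[of _ \<Omega>] exI[of _ "\<lambda>n x. schoenberg_I v (Y n x)"]
      exI[of _ "\<lambda>x. schoenberg_I v (X x)"]) simp
  with r show ?thesis by (rule that)
qed

text \<open>The general codomain admits the complex integrands of characteristic functions.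
  Compactness of the square provides the dominating constant.\<close>

lemma skorohod_limit_integral:
  fixes f :: "real \<times> real \<Rightarrow> 'b :: {banach, second_countable_topology}"
  assumes "skorohod_limit v \<sigma> p"
    and f [measurable]: "f \<in> borel_measurable (pair_I v)"
    and cont: "continuous_on ({v..1} \<times> {v..1}) f"
  shows "(\<lambda>n. \<integral>x. f x \<partial>\<sigma> n) \<longlonglongrightarrow> (\<integral>x. f x \<partial>p)"
proof -
  obtain \<Omega> :: "real measure" and Y X where \<Omega>: "prob_space \<Omega>"
    and Y [measurable]: "\<And>n. Y n \<in> measurable \<Omega> (pair_I v)"
    and dY: "\<And>n. distr \<Omega> (pair_I v) (Y n) = \<sigma> n"
    and X [measurable]: "X \<in> measurable \<Omega> (pair_I v)"
    and dX: "distr \<Omega> (pair_I v) X = p"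
    and lim: "\<And>\<omega>. \<omega> \<in> space \<Omega> \<Longrightarrow> (\<lambda>n. Y n \<omega>) \<longlonglongrightarrow> X \<omega>"
    using assms(1) unfolding skorohod_limit_def by blast
  interpret prob_space \<Omega> by (rule \<Omega>)
  have Ysp: "Y n \<omega> \<in> {v..1} \<times> {v..1}" if "\<omega> \<in> space \<Omega>" for n \<omega>
    using measurable_space[OF Y that] by (simp add: space_pair_I)
  have Xsp: "X \<omega> \<in> {v..1} \<times> {v..1}" if "\<omega> \<in> space \<Omega>" for \<omega>
    using measurable_space[OF X that] by (simp add: space_pair_I)
  have "bounded (f ` ({v..1} \<times> {v..1}))"
    by (intro compact_imp_bounded compact_continuous_image cont compact_Times compact_Icc)
  then obtain B where B: "\<And>z. z \<in> {v..1} \<times> {v..1} \<Longrightarrow> norm (f z) \<le> B"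
    unfolding bounded_iff by blast
  have "(\<lambda>n. \<integral>\<omega>. f (Y n \<omega>) \<partial>\<Omega>) \<longlonglongrightarrow> (\<integral>\<omega>. f (X \<omega>) \<partial>\<Omega>)"
  proof (rule integral_dominated_convergence[where w = "\<lambda>_. B"])
    show "AE \<omega> in \<Omega>. (\<lambda>n. f (Y n \<omega>)) \<longlonglongrightarrow> f (X \<omega>)"
      using continuous_on_tendsto_compose[OF cont lim Xsp] Ysp
      by (intro AE_I2) (simp add: always_eventually)
    show "AE \<omega> in \<Omega>. norm (f (Y n \<omega>)) \<le> B" for n
      using B Ysp by (intro AE_I2) simp
  qed auto
  then show ?thesis
    by (simp add: integral_distr flip: dY dX)
qed

text \<open>Both constraints prescribe integrals of continuous functions, and these survive the
  limit. For the marginal the functions are the exponentials \<open>iexp (t * fst x)\<close>,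
  because a law is determined by its characteristic function.\<close>

lemma strategies_closed:
  assumes lim: "skorohod_limit v \<sigma> p" and \<sigma>: "\<And>n. \<sigma> n \<in> strategies v F"
    and F: "is_prior v F"
  shows "p \<in> strategies v F"
proof -
  obtain \<Omega> :: "real measure" and X where "prob_space \<Omega>" and X: "X \<in> measurable \<Omega> (pair_I v)"
    and dX: "distr \<Omega> (pair_I v) X = p"
    using lim unfolding skorohod_limit_def by blast
  then have "prob_space p" by (metis prob_space.prob_space_distr)
  then interpret p: prob_space p .
  interpret F: prob_space F using F by (simp add: is_prior_def)
  have sets_p: "sets p = sets (pair_I v)" using dX by auto
  have \<sigma>': "prob_space (\<sigma> n)" "sets (\<sigma> n) = sets (pair_I v)" "distr (\<sigma> n) (borel_I v) fst = F" for n
    using \<sigma>[of n] by (auto simp: strategies_def)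
  have sets_F: "sets F = sets (borel_I v)" using F by (simp add: is_prior_def)
  have meas_p: "f \<in> measurable p N" if "f \<in> measurable (pair_I v) N" for f :: "real \<times> real \<Rightarrow> 'c" and N
    using that measurable_cong_sets[OF sets_p refl] by blast
  have meas_\<sigma>: "f \<in> measurable (\<sigma> n) N" if "f \<in> measurable (pair_I v) N" for f :: "real \<times> real \<Rightarrow> 'c" and n N
    using that measurable_cong_sets[OF \<sigma>'(2) refl] by blast
  have id_F: "(\<lambda>x. x) \<in> borel_measurable F"
    using measurable_borel_I_ident measurable_cong_sets[OF sets_F refl] by blast

  have "(\<integral>x. (fst x - snd x) * h (snd x) \<partial>p) = 0" if h: "continuous_on {v..1} h" for h :: "real \<Rightarrow> real"
  proof -
    have "(\<lambda>n. \<integral>x. (fst x - snd x) * h (snd x) \<partial>\<sigma> n) \<longlonglongrightarrow> (\<integral>x. (fst x - snd x) * h (snd x) \<partial>p)"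
    proof (rule skorohod_limit_integral[OF lim])
      note [measurable] = measurable_compose[OF measurable_snd borel_measurable_continuous_on_I[OF h]]
      show "(\<lambda>x. (fst x - snd x) * h (snd x)) \<in> borel_measurable (pair_I v)" by measurable
      show "continuous_on ({v..1} \<times> {v..1}) (\<lambda>x. (fst x - snd x) * h (snd x))"
        by (intro continuous_intros continuous_on_compose2[OF h]) auto
    qed
    moreover have "(\<integral>x. (fst x - snd x) * h (snd x) \<partial>\<sigma> n) = 0" for n
      using \<sigma>[of n] h by (simp add: strategies_def)
    ultimately show ?thesis by (simp add: LIMSEQ_const_iff)
  qed
  moreover have "distr p (borel_I v) fst = F"
  proof -
    have "char (distr p borel fst) = char (distr F borel (\<lambda>x. x))"
    proof
      fix t
      have "(\<lambda>n. \<integral>x. iexp (t * fst x) \<partial>\<sigma> n) \<longlonglongrightarrow> (\<integral>x. iexp (t * fst x) \<partial>p)"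
        by (rule skorohod_limit_integral[OF lim]) (auto intro!: continuous_intros)
      moreover have "(\<integral>x. iexp (t * fst x) \<partial>\<sigma> n) = (\<integral>x. iexp (t * x) \<partial>F)" for n
        using meas_\<sigma>[OF measurable_fst, of n]
        by (subst \<sigma>'(3)[of n, symmetric], subst integral_distr) auto
      ultimately have "(\<integral>x. iexp (t * fst x) \<partial>p) = (\<integral>x. iexp (t * x) \<partial>F)"
        by (simp add: LIMSEQ_const_iff)
      then show "char (distr p borel fst) t = char (distr F borel (\<lambda>x. x)) t"
        unfolding char_def using meas_p[OF measurable_pair_I_fst] id_F
        by (simp add: integral_distr)
    qed
    then have eq: "distr p borel fst = distr F borel (\<lambda>x. x)"
      using meas_p[OF measurable_pair_I_fst] id_F
      by (intro Levy_uniqueness p.real_distribution_distr F.real_distribution_distr)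
    \<comment> \<open>Equality is now known for the laws on all reals; it remains to pass to the
      Borel sets of the interval.\<close>
    show ?thesis
    proof (rule measure_eqI)
      fix A assume "A \<in> sets (distr p (borel_I v) fst)"
      then have A: "A \<in> sets (borel_I v)" by simp
      then have Ab: "A \<in> sets borel" and "A \<subseteq> {v..1}"
        by (auto simp: borel_I_def sets_restrict_space_iff)
      have "emeasure (distr p (borel_I v) fst) A = emeasure (distr p borel fst) A"
        using A Ab meas_p[OF measurable_pair_I_fst] meas_p[OF measurable_fst]
        by (simp add: emeasure_distr)
      also have "\<dots> = emeasure F (A \<inter> space F)"
        unfolding eq using Ab id_F by (simp add: emeasure_distr)
      also have "A \<inter> space F = A"
        using \<open>A \<subseteq> {v..1}\<close> sets_eq_imp_space_eq[OF sets_F] by auto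
      finally show "emeasure (distr p (borel_I v) fst) A = emeasure F A" .
    qed (simp add: sets_F)
  qed
  ultimately show ?thesis
    using \<open>prob_space p\<close> sets_p by (simp add: strategies_def)
qed

text \<open>Full disclosure, where the message equals the value, is the witness: the factor
  \<open>fst x - snd x\<close> vanishes on the diagonal.\<close>

lemma strategies_nonempty:
  assumes F: "is_prior v F"
  shows "strategies v F \<noteq> {}"
proof -
  interpret F: prob_space F using F by (simp add: is_prior_def)
  have sets_F: "sets F = sets (borel_I v)" using F by (simp add: is_prior_def)
  define p where "p = distr F (pair_I v) (\<lambda>x. (x, x))"
  have diag: "(\<lambda>x. (x, x)) \<in> measurable F (pair_I v)"
    using sets_F by (intro measurable_Pair) (auto intro: measurable_ident_sets)
  have "distr p (borel_I v) fst = distr F (borel_I v) (\<lambda>x. x)"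
    unfolding p_def by (subst distr_distr[OF measurable_fst diag]) (simp add: comp_def)
  also have "\<dots> = distr F F (\<lambda>x. x)"
    by (rule distr_cong) (simp_all add: sets_F)
  finally have "distr p (borel_I v) fst = F" by simp
  moreover have "(\<integral>x. (fst x - snd x) * h (snd x) \<partial>p) = 0"
    if h: "continuous_on {v..1} h" for h :: "real \<Rightarrow> real"
  proof -
    note [measurable] = measurable_compose[OF measurable_snd borel_measurable_continuous_on_I[OF h]]
    have "(\<lambda>x. (fst x - snd x) * h (snd x)) \<in> borel_measurable (pair_I v)" by measurable
    from integral_distr[OF diag this] show ?thesis unfolding p_def by simp
  qed
  ultimately have "p \<in> strategies v F"
    using F.prob_space_distr[OF diag] by (simp add: strategies_def p_def)
  then show ?thesis by blast
qed

section \<open>Finite mixtures of strategies\<close>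

definition mixture :: "nat \<Rightarrow> (nat \<Rightarrow> real) \<Rightarrow> (nat \<Rightarrow> 'a measure) \<Rightarrow> 'a measure" where
  "mixture M w q = point_measure {..<M} w \<bind> q"

text \<open>A mixture is a bind in the Giry monad: an index is drawn with law \<open>w\<close>, then
  a point from \<open>q\<close> at this index. Measurability of \<open>q\<close> is automatic since
  the index space is discrete, and the bound \<open>C\<close> permits integrating in two
  stages.\<close>

lemma
  fixes q :: "nat \<Rightarrow> 'a measure"
  assumes w: "w \<in> simplex_weights M"
    and q: "\<And>l. l < M \<Longrightarrow> prob_space (q l)" "\<And>l. l < M \<Longrightarrow> sets (q l) = sets B"
  shows sets_mixture: "sets (mixture M w q) = sets B"
    and prob_space_mixture: "prob_space (mixture M w q)"
    and integral_mixture: "\<And>f :: 'a \<Rightarrow> real. f \<in> borel_measurable B \<Longrightarrow>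
      (\<And>x. x \<in> space B \<Longrightarrow> \<bar>f x\<bar> \<le> C) \<Longrightarrow> (\<integral>x. f x \<partial>mixture M w q) = (\<Sum>l<M. w l * (\<integral>x. f x \<partial>q l))"
proof -
  have w0: "\<And>l. l < M \<Longrightarrow> 0 \<le> w l" and w1: "(\<Sum>l<M. w l) = 1"
    using w by (auto simp: simplex_weights_def)
  have "emeasure (point_measure {..<M} w) {..<M} = (\<Sum>l<M. ennreal (w l))"
    by (subst emeasure_point_measure_finite) auto
  also have "\<dots> = 1" using w0 w1 by (subst sum_ennreal) auto
  finally interpret P: prob_space "point_measure {..<M} w"
    by (intro prob_spaceI) (simp add: space_point_measure)
  have q': "q \<in> measurable (point_measure {..<M} w) (prob_algebra B)"
    using q by (simp add: measurable_point_measure_eq1 space_prob_algebra)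
  have P: "point_measure {..<M} w \<in> space (prob_algebra (point_measure {..<M} w))"
    by (simp add: space_prob_algebra P.prob_space_axioms)
  show "sets (mixture M w q) = sets B" unfolding mixture_def by (rule sets_bind'[OF P q'])
  show "prob_space (mixture M w q)" unfolding mixture_def by (rule prob_space_bind'[OF P q'])
  fix f :: "'a \<Rightarrow> real" assume f: "f \<in> borel_measurable B" "\<And>x. x \<in> space B \<Longrightarrow> \<bar>f x\<bar> \<le> C"
  have "(\<integral>x. f x \<partial>mixture M w q) = (\<integral>l. (\<integral>x. f x \<partial>q l) \<partial>point_measure {..<M} w)"
    unfolding mixture_def
  proof (rule integral_bind[OF f measurable_prob_algebraD[OF q'] P.finite_measure_axioms])
    show "AE l in point_measure {..<M} w. emeasure (q l) (space (q l)) \<le> ennreal 1"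
      using q(1) by (intro AE_I2) (simp add: space_point_measure prob_space.emeasure_space_1)
  qed
  also have "\<dots> = (\<Sum>l<M. w l * (\<integral>x. f x \<partial>q l))"
    using w0 by (subst lebesgue_integral_point_measure_finite) auto
  finally show "(\<integral>x. f x \<partial>mixture M w q) = (\<Sum>l<M. w l * (\<integral>x. f x \<partial>q l))" .
qed

text \<open>Both constraints are linear in the measure. In contrast to weak limits, mixtures respect
  the integrals of all bounded measurable functions, so indicators settle the marginal
  directly.\<close>

lemma mixture_strategies:
  assumes w: "w \<in> simplex_weights M" and q: "\<And>l. l < M \<Longrightarrow> q l \<in> strategies v F"
    and F: "is_prior v F"
  shows "mixture M w q \<in> strategies v F"
proof -
  have q': "prob_space (q l)" "sets (q l) = sets (pair_I v)" "distr (q l) (borel_I v) fst = F" if "l < M" for l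
    using q[OF that] by (auto simp: strategies_def)
  have mix: "sets (mixture M w q) = sets (pair_I v)" "prob_space (mixture M w q)"
    by (rule sets_mixture[OF w] prob_space_mixture[OF w]; use q' in blast)+
  note int_mix = integral_mixture[OF w q'(1,2), simplified]
  interpret m: prob_space "mixture M w q" using mix(2) by simp
  interpret F: prob_space F using F by (simp add: is_prior_def)
  have w1: "(\<Sum>l<M. w l) = 1" using w by (simp add: simplex_weights_def)
  have sets_F: "sets F = sets (borel_I v)" using F by (simp add: is_prior_def)
  have fst_m: "fst \<in> measurable N (borel_I v)" if "sets N = sets (pair_I v)" for N
    using measurable_cong_sets[OF that refl] measurable_fst by blast
  have "(\<integral>x. (fst x - snd x) * h (snd x) \<partial>mixture M w q) = 0"
    if h: "continuous_on {v..1} h" for h :: "real \<Rightarrow> real"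
  proof -
    note [measurable] = measurable_compose[OF measurable_snd borel_measurable_continuous_on_I[OF h]]
    have "bounded ((\<lambda>x. (fst x - snd x) * h (snd x)) ` ({v..1} \<times> {v..1}))"
      by (intro compact_imp_bounded compact_continuous_image continuous_intros
        continuous_on_compose2[OF h] compact_Times compact_Icc) auto
    then obtain C where "\<And>x. x \<in> space (pair_I v) \<Longrightarrow> \<bar>(fst x - snd x) * h (snd x)\<bar> \<le> C"
      unfolding bounded_iff space_pair_I real_norm_def by blast
    then have "(\<integral>x. (fst x - snd x) * h (snd x) \<partial>mixture M w q) =
        (\<Sum>l<M. w l * (\<integral>x. (fst x - snd x) * h (snd x) \<partial>q l))"
      by (intro int_mix) auto
    also have "\<dots> = 0" using q h by (intro sum.neutral) (simp add: strategies_def)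
    finally show ?thesis .
  qed
  moreover have "distr (mixture M w q) (borel_I v) fst = F"
  proof (rule measure_eqI)
    fix A assume "A \<in> sets (distr (mixture M w q) (borel_I v) fst)"
    then have A [measurable]: "A \<in> sets (borel_I v)" by simp
    have meas_eq: "measure (distr N (borel_I v) fst) A = (\<integral>x. indicator A (fst x) \<partial>N)"
      if "sets N = sets (pair_I v)" "prob_space N" for N
    proof -
      interpret N: prob_space N by fact
      have "measure (distr N (borel_I v) fst) A = measure N (fst -` A \<inter> space N)"
        using fst_m[OF that(1)] A by (rule measure_distr)
      also have "\<dots> = (\<integral>x. indicator (fst -` A) x \<partial>N)" by simp
      also have "\<dots> = (\<integral>x. indicator A (fst x) \<partial>N)" by (simp add: indicator_def vimage_def)
      finally show ?thesis .
    qed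
    have "measure (distr (mixture M w q) (borel_I v) fst) A = (\<Sum>l<M. w l * (\<integral>x. indicator A (fst x) \<partial>q l))"
      using mix by (subst meas_eq, simp, simp) (rule int_mix[where C = 1], auto)
    also have "\<dots> = (\<Sum>l<M. w l * measure F A)"
      using q' meas_eq by (intro sum.cong refl arg_cong2[where f = "(*)"]) (metis lessThan_iff)
    also have "\<dots> = measure F A" using w1 by (simp flip: sum_distrib_right)
    finally have eq: "measure (distr (mixture M w q) (borel_I v) fst) A = measure F A" .
    interpret d: prob_space "distr (mixture M w q) (borel_I v) fst"
      using fst_m mix(1) by (intro m.prob_space_distr) simp
    show "emeasure (distr (mixture M w q) (borel_I v) fst) A = emeasure F A"
      by (simp add: eq d.emeasure_eq_measure F.emeasure_eq_measure)
  qed (simp add: sets_F)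
  ultimately show ?thesis
    using mix by (simp add: strategies_def)
qed

section \<open>Continuity and affinity of payoffs\<close>

text \<open>This joins representations of the single coordinates into one of the independent
  profile; the two measures agree on boxes, which determine a finite product.\<close>

lemma distr_PiM_coordinatewise:
  assumes "finite I" and \<Omega>: "\<And>i. prob_space (\<Omega> i)"
    and Y: "\<And>i. Y i \<in> measurable (\<Omega> i) (N i)"
  shows "distr (PiM I \<Omega>) (PiM I N) (\<lambda>\<omega>. \<lambda>i\<in>I. Y i (\<omega> i)) = PiM I (\<lambda>i. distr (\<Omega> i) (N i) (Y i))"
proof -
  interpret P: product_sigma_finite "\<lambda>i. distr (\<Omega> i) (N i) (Y i)"
    by (intro product_sigma_finite.intro prob_space_imp_sigma_finite prob_space.prob_space_distr \<Omega> Y)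
  interpret Q: product_sigma_finite \<Omega>
    by (intro product_sigma_finite.intro prob_space_imp_sigma_finite \<Omega>)
  have meas: "(\<lambda>\<omega>. \<lambda>i\<in>I. Y i (\<omega> i)) \<in> measurable (PiM I \<Omega>) (PiM I N)"
    by (rule measurable_restrict) (rule measurable_compose[OF measurable_component_singleton], assumption, rule Y)
  show ?thesis
  proof (rule P.PiM_eqI)
    fix A assume "\<And>i. i \<in> I \<Longrightarrow> A i \<in> sets (distr (\<Omega> i) (N i) (Y i))"
    then have A: "A i \<in> sets (N i)" if "i \<in> I" for i using that by simp
    have "(\<lambda>\<omega>. \<lambda>i\<in>I. Y i (\<omega> i)) -` (Pi\<^sub>E I A) \<inter> space (PiM I \<Omega>) =
        (\<Pi>\<^sub>E i\<in>I. Y i -` A i \<inter> space (\<Omega> i))"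
      by (auto simp: space_PiM PiE_iff)
    then have "emeasure (distr (PiM I \<Omega>) (PiM I N) (\<lambda>\<omega>. \<lambda>i\<in>I. Y i (\<omega> i))) (Pi\<^sub>E I A) =
        emeasure (PiM I \<Omega>) (\<Pi>\<^sub>E i\<in>I. Y i -` A i \<inter> space (\<Omega> i))"
      using A by (subst emeasure_distr[OF meas]) (auto intro!: sets_PiM_I_finite \<open>finite I\<close>)
    also have "\<dots> = (\<Prod>i\<in>I. emeasure (\<Omega> i) (Y i -` A i \<inter> space (\<Omega> i)))"
      using A Y by (intro Q.emeasure_PiM \<open>finite I\<close> measurable_sets)
    also have "\<dots> = (\<Prod>i\<in>I. emeasure (distr (\<Omega> i) (N i) (Y i)) (A i))"
      using A Y by (intro prod.cong) (auto simp: emeasure_distr)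
    finally show "emeasure (distr (PiM I \<Omega>) (PiM I N) (\<lambda>\<omega>. \<lambda>i\<in>I. Y i (\<omega> i))) (Pi\<^sub>E I A) =
        (\<Prod>i\<in>I. emeasure (distr (\<Omega> i) (N i) (Y i)) (A i))" .
  qed (auto simp: \<open>finite I\<close> intro!: sets_PiM_cong)
qed

definition payoff ::
  "nat \<Rightarrow> ((nat \<Rightarrow> real \<times> real) \<Rightarrow> real) \<Rightarrow> (nat \<Rightarrow> (real \<times> real) measure) \<Rightarrow> real" where
  "payoff N G \<pi> = (\<integral>x. G x \<partial>PiM {..<N} \<pi>)"

text \<open>\<open>G\<close> abstracts a payoff as a function of the realized values and messages,
  with the noise already averaged out. Its continuity is in the realizations; continuity in the
  strategies is derived from it.\<close>

locale regular_payoff =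
  fixes N :: nat and v :: real and G :: "(nat \<Rightarrow> real \<times> real) \<Rightarrow> real" and C :: real
  assumes meas: "G \<in> borel_measurable (PiM {..<N} (\<lambda>_. pair_I v))"
    and bound: "\<And>x. x \<in> space (PiM {..<N} (\<lambda>_. pair_I v)) \<Longrightarrow> \<bar>G x\<bar> \<le> C"
    and seq_cont: "\<And>X x. (\<And>n j. j < N \<Longrightarrow> X n j \<in> {v..1} \<times> {v..1}) \<Longrightarrow>
      (\<And>j. j < N \<Longrightarrow> x j \<in> {v..1} \<times> {v..1}) \<Longrightarrow>
      (\<And>j. j < N \<Longrightarrow> (\<lambda>n. X n j) \<longlonglongrightarrow> x j) \<Longrightarrow> (\<lambda>n. G (X n)) \<longlonglongrightarrow> G x"
begin

text \<open>The product of the Skorohod spaces of the coordinates carries profiles that converge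
  pointwise and have the given product laws, so dominated convergence applies.\<close>

lemma payoff_tendsto:
  assumes "\<And>j. skorohod_limit v (\<lambda>n. \<sigma> n j) (p j)"
  shows "(\<lambda>n. payoff N G (\<sigma> n)) \<longlonglongrightarrow> payoff N G p"
proof -
  have "\<forall>j. \<exists>(\<Omega> :: real measure) Y X. prob_space \<Omega> \<and>
     (\<forall>n. Y n \<in> measurable \<Omega> (pair_I v)) \<and> (\<forall>n. distr \<Omega> (pair_I v) (Y n) = \<sigma> n j) \<and>
     X \<in> measurable \<Omega> (pair_I v) \<and> distr \<Omega> (pair_I v) X = p j \<and>
     (\<forall>\<omega>\<in>space \<Omega>. (\<lambda>n. Y n \<omega>) \<longlonglongrightarrow> X \<omega>)"
    using assms unfolding skorohod_limit_def by blast
  from choice[OF this] obtain \<Omega> :: "nat \<Rightarrow> real measure" where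
    "\<forall>j. \<exists>Y X. prob_space (\<Omega> j) \<and>
     (\<forall>n. Y n \<in> measurable (\<Omega> j) (pair_I v)) \<and> (\<forall>n. distr (\<Omega> j) (pair_I v) (Y n) = \<sigma> n j) \<and>
     X \<in> measurable (\<Omega> j) (pair_I v) \<and> distr (\<Omega> j) (pair_I v) X = p j \<and>
     (\<forall>\<omega>\<in>space (\<Omega> j). (\<lambda>n. Y n \<omega>) \<longlonglongrightarrow> X \<omega>)" ..
  from choice[OF this] obtain Y where
    "\<forall>j. \<exists>X. prob_space (\<Omega> j) \<and>
     (\<forall>n. Y j n \<in> measurable (\<Omega> j) (pair_I v)) \<and> (\<forall>n. distr (\<Omega> j) (pair_I v) (Y j n) = \<sigma> n j) \<and>
     X \<in> measurable (\<Omega> j) (pair_I v) \<and> distr (\<Omega> j) (pair_I v) X = p j \<and>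
     (\<forall>\<omega>\<in>space (\<Omega> j). (\<lambda>n. Y j n \<omega>) \<longlonglongrightarrow> X \<omega>)" ..
  from choice[OF this] obtain X where
    *: "\<forall>j. prob_space (\<Omega> j) \<and>
     (\<forall>n. Y j n \<in> measurable (\<Omega> j) (pair_I v)) \<and> (\<forall>n. distr (\<Omega> j) (pair_I v) (Y j n) = \<sigma> n j) \<and>
     X j \<in> measurable (\<Omega> j) (pair_I v) \<and> distr (\<Omega> j) (pair_I v) (X j) = p j \<and>
     (\<forall>\<omega>\<in>space (\<Omega> j). (\<lambda>n. Y j n \<omega>) \<longlonglongrightarrow> X j \<omega>)" ..
  have \<Omega>: "prob_space (\<Omega> j)" for j using * by simp
  have Y: "Y j n \<in> measurable (\<Omega> j) (pair_I v)" for j n using * by simp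
  have X: "X j \<in> measurable (\<Omega> j) (pair_I v)" for j using * by simp
  have dY: "distr (\<Omega> j) (pair_I v) (Y j n) = \<sigma> n j" for j n using * by simp
  have dX: "distr (\<Omega> j) (pair_I v) (X j) = p j" for j using * by simp
  have lim: "(\<lambda>n. Y j n \<omega>) \<longlonglongrightarrow> X j \<omega>" if "\<omega> \<in> space (\<Omega> j)" for j \<omega> using * that by simp
  define P where "P = PiM {..<N} \<Omega>"
  interpret P: prob_space P unfolding P_def by (intro prob_space_PiM \<Omega>)
  have joint: "(\<lambda>\<omega>. \<lambda>j\<in>{..<N}. Z j (\<omega> j)) \<in> measurable P (PiM {..<N} (\<lambda>_. pair_I v))"
    if "\<And>j. Z j \<in> measurable (\<Omega> j) (pair_I v)" for Z
    unfolding P_def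
    by (rule measurable_restrict) (rule measurable_compose[OF measurable_component_singleton], assumption, rule that)
  have payoff_eq: "payoff N G \<rho> = (\<integral>\<omega>. G (\<lambda>j\<in>{..<N}. Z j (\<omega> j)) \<partial>P)"
    if Z: "\<And>j. Z j \<in> measurable (\<Omega> j) (pair_I v)" and "\<And>j. distr (\<Omega> j) (pair_I v) (Z j) = \<rho> j" for \<rho> Z
  proof -
    have "PiM {..<N} \<rho> = distr P (PiM {..<N} (\<lambda>_. pair_I v)) (\<lambda>\<omega>. \<lambda>j\<in>{..<N}. Z j (\<omega> j))"
      unfolding P_def by (subst distr_PiM_coordinatewise[OF _ \<Omega> Z]) (simp_all add: that(2))
    then show ?thesis
      unfolding payoff_def by (simp add: integral_distr[OF joint[OF Z] meas])
  qed
  have sp: "Z j (\<omega> j) \<in> {v..1} \<times> {v..1}"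
    if "\<omega> \<in> space P" "j < N" "\<And>j. Z j \<in> measurable (\<Omega> j) (pair_I v)" for Z \<omega> j
    using measurable_space[OF that(3), of "\<omega> j"] that(1,2)
    by (auto simp: P_def space_PiM PiE_iff space_pair_I)
  have "(\<lambda>n. \<integral>\<omega>. G (\<lambda>j\<in>{..<N}. Y j n (\<omega> j)) \<partial>P) \<longlonglongrightarrow> (\<integral>\<omega>. G (\<lambda>j\<in>{..<N}. X j (\<omega> j)) \<partial>P)"
  proof (rule integral_dominated_convergence[where w = "\<lambda>_. C"])
    show "(\<lambda>\<omega>. G (\<lambda>j\<in>{..<N}. X j (\<omega> j))) \<in> borel_measurable P"
      by (rule measurable_compose[OF joint meas]) (rule X)
    show "(\<lambda>\<omega>. G (\<lambda>j\<in>{..<N}. Y j n (\<omega> j))) \<in> borel_measurable P" for n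
      by (rule measurable_compose[OF joint meas]) (rule Y)
    show "AE \<omega> in P. norm (G (\<lambda>j\<in>{..<N}. Y j n (\<omega> j))) \<le> C" for n
    proof (rule AE_I2)
      fix \<omega> assume "\<omega> \<in> space P"
      from bound[OF measurable_space[OF joint[of "\<lambda>j. Y j n", OF Y] this]]
      show "norm (G (\<lambda>j\<in>{..<N}. Y j n (\<omega> j))) \<le> C" by simp
    qed
    show "AE \<omega> in P. (\<lambda>n. G (\<lambda>j\<in>{..<N}. Y j n (\<omega> j))) \<longlonglongrightarrow> G (\<lambda>j\<in>{..<N}. X j (\<omega> j))"
    proof (rule AE_I2, rule seq_cont)
      fix \<omega> assume \<omega>: "\<omega> \<in> space P"
      show "(\<lambda>j\<in>{..<N}. Y j n (\<omega> j)) j \<in> {v..1} \<times> {v..1}" if "j < N" for n j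
        using sp[OF \<omega> that, of "\<lambda>j. Y j n", OF Y] that by simp
      show "(\<lambda>j\<in>{..<N}. X j (\<omega> j)) j \<in> {v..1} \<times> {v..1}" if "j < N" for j
        using sp[OF \<omega> that X] that by simp
      show "(\<lambda>n. (\<lambda>j\<in>{..<N}. Y j n (\<omega> j)) j) \<longlonglongrightarrow> (\<lambda>j\<in>{..<N}. X j (\<omega> j)) j" if "j < N" for j
        using lim[of "\<omega> j" j] \<omega> that by (auto simp: P_def space_PiM PiE_iff)
    qed
  qed simp
  then show ?thesis
    using payoff_eq[of "\<lambda>j. Y j n" "\<sigma> n" for n, OF Y dY] payoff_eq[of X p, OF X dX] by simp
qed

text \<open>By Fubini, coordinate \<open>j\<close> can be integrated first, inside an outer measure
  \<open>R\<close> that does not depend on the strategy there; the inner integral is linear in that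
  strategy.\<close>

lemma payoff_affine:
  assumes \<pi>: "\<And>i. prob_space (\<pi> i)" "\<And>i. sets (\<pi> i) = sets (pair_I v)"
    and "j < N" and w: "w \<in> simplex_weights M"
    and q: "\<And>l. l < M \<Longrightarrow> prob_space (q l)" "\<And>l. l < M \<Longrightarrow> sets (q l) = sets (pair_I v)"
  shows "payoff N G (\<pi>(j := mixture M w q)) = (\<Sum>l<M. w l * payoff N G (\<pi>(j := q l)))"
proof -
  define I where "I = {..<N} - {j}"
  have I: "finite I" "j \<notin> I" "{..<N} = insert j I" using \<open>j < N\<close> by (auto simp: I_def)
  define R where "R = PiM I \<pi>"
  interpret R: prob_space R unfolding R_def by (intro prob_space_PiM \<pi>)
  have split: "payoff N G (\<pi>(j := r)) = (\<integral>x. (\<integral>y. G (x(j := y)) \<partial>r) \<partial>R)"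
    and int: "integrable R (\<lambda>x. \<integral>y. G (x(j := y)) \<partial>r)"
    if r: "prob_space r" "sets r = sets (pair_I v)" for r
  proof -
    interpret r: prob_space r by (rule r)
    interpret P: product_sigma_finite "\<pi>(j := r)"
      using \<pi> r by (intro product_sigma_finite.intro prob_space_imp_sigma_finite) simp
    have sets_eq: "sets (PiM {..<N} (\<pi>(j := r))) = sets (PiM {..<N} (\<lambda>_. pair_I v))"
      using \<pi> r by (intro sets_PiM_cong) auto
    have G: "G \<in> borel_measurable (PiM {..<N} (\<pi>(j := r)))"
      using meas measurable_cong_sets[OF sets_eq refl] by blast
    have G_bound: "\<bar>G x\<bar> \<le> C" if "x \<in> space (PiM {..<N} (\<pi>(j := r)))" for x
      using that bound sets_eq_imp_space_eq[OF sets_eq] by simp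
    have R: "PiM I (\<pi>(j := r)) = R"
      unfolding R_def using I(2) by (intro PiM_cong) auto
    interpret Q: prob_space "PiM {..<N} (\<pi>(j := r))"
      using \<pi> r by (intro prob_space_PiM) simp
    have "integrable (PiM (insert j I) (\<pi>(j := r))) G"
      using G G_bound unfolding I(3)[symmetric]
      by (intro Q.integrable_const_bound[where B = C]) (auto intro: AE_I2)
    from P.product_integral_insert[OF I(1,2) this]
    show "payoff N G (\<pi>(j := r)) = (\<integral>x. (\<integral>y. G (x(j := y)) \<partial>r) \<partial>R)"
      unfolding payoff_def I(3) R by simp
    have add_dim: "(\<lambda>(x, y). x(j := y)) \<in> measurable (R \<Otimes>\<^sub>M r) (PiM {..<N} (\<pi>(j := r)))"
      using measurable_add_dim[of j I "\<pi>(j := r)"] unfolding I(3) R by simp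
    have Gm: "(\<lambda>z. G ((fst z)(j := snd z))) \<in> borel_measurable (R \<Otimes>\<^sub>M r)"
      using measurable_compose[OF add_dim G] by (simp add: case_prod_beta')
    have upd: "x(j := y) \<in> space (PiM {..<N} (\<pi>(j := r)))" if "x \<in> space R" "y \<in> space r" for x y
      using measurable_space[OF add_dim, of "(x, y)"] that by (simp add: space_pair_measure)
    show "integrable R (\<lambda>x. \<integral>y. G (x(j := y)) \<partial>r)"
    proof (rule R.integrable_const_bound[where B = C])
      show "(\<lambda>x. \<integral>y. G (x(j := y)) \<partial>r) \<in> borel_measurable R"
        using Gm by (intro r.borel_measurable_lebesgue_integral) (simp add: case_prod_beta')
      show "AE x in R. norm (\<integral>y. G (x(j := y)) \<partial>r) \<le> C"
      proof (rule AE_I2)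
        fix x assume x: "x \<in> space R"
        have "norm (\<integral>y. G (x(j := y)) \<partial>r) \<le> (\<integral>y. norm (G (x(j := y))) \<partial>r)"
          by (rule integral_norm_bound)
        also have "\<dots> \<le> (\<integral>y. C \<partial>r)"
        proof (rule integral_mono)
          have "(\<lambda>y. G (x(j := y))) \<in> borel_measurable r"
            using measurable_compose[OF measurable_Pair1'[OF x] Gm] by simp
          then show "integrable r (\<lambda>y. norm (G (x(j := y))))"
            using G_bound upd[OF x]
            by (intro integrable_norm r.integrable_const_bound[where B = C]) (auto intro: AE_I2)
        qed (use G_bound upd[OF x] in auto)
        finally show "norm (\<integral>y. G (x(j := y)) \<partial>r) \<le> C" by (simp add: r.prob_space)
      qed
    qed
  qed
  have inner: "(\<integral>y. G (x(j := y)) \<partial>mixture M w q) = (\<Sum>l<M. w l * (\<integral>y. G (x(j := y)) \<partial>q l))"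
    if x: "x \<in> space R" for x
  proof (rule integral_mixture[OF w q])
    have upd: "(\<lambda>y. x(j := y)) \<in> measurable (pair_I v) (PiM {..<N} (\<lambda>_. pair_I v))"
    proof -
      have "x \<in> space (PiM I (\<lambda>_. pair_I v))"
        using x \<pi>(2)[THEN sets_eq_imp_space_eq] by (simp add: R_def space_PiM)
      from measurable_compose[OF measurable_Pair1'[OF this] measurable_add_dim[of j I "\<lambda>_. pair_I v"]]
      show ?thesis unfolding I(3) by simp
    qed
    show "(\<lambda>y. G (x(j := y))) \<in> borel_measurable (pair_I v)"
      by (rule measurable_compose[OF upd meas])
    show "\<bar>G (x(j := y))\<bar> \<le> C" if "y \<in> space (pair_I v)" for y
      by (rule bound[OF measurable_space[OF upd that]])
  qed auto
  have "payoff N G (\<pi>(j := mixture M w q)) = (\<integral>x. (\<integral>y. G (x(j := y)) \<partial>mixture M w q) \<partial>R)"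
    by (intro split prob_space_mixture[OF w q] sets_mixture[OF w q])
  also have "\<dots> = (\<integral>x. (\<Sum>l<M. w l * (\<integral>y. G (x(j := y)) \<partial>q l)) \<partial>R)"
    by (intro Bochner_Integration.integral_cong refl inner)
  also have "\<dots> = (\<Sum>l<M. w l * payoff N G (\<pi>(j := q l)))"
    using int q split by (subst Bochner_Integration.integral_sum) (auto intro!: sum.cong)
  finally show ?thesis .
qed

text \<open>All coordinates in \<open>A\<close> are mixed with the same weights, so the payoff is a
  polynomial in them. Expanding one coordinate by affinity leaves payoffs with fewer mixed
  coordinates; the pure choice made there is absorbed into \<open>b\<close>, which the induction
  therefore leaves arbitrary.\<close>

lemma payoff_mixture_tendsto:
  assumes W: "\<And>n. W n \<in> simplex_weights M" "w \<in> simplex_weights M"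
    and lim: "\<And>l. l < M \<Longrightarrow> (\<lambda>n. W n l) \<longlonglongrightarrow> w l"
    and q: "\<And>l j. l < M \<Longrightarrow> prob_space (q l j)" "\<And>l j. l < M \<Longrightarrow> sets (q l j) = sets (pair_I v)"
    and A: "finite A" "A \<subseteq> {..<N}"
    and b: "\<And>j. prob_space (b j)" "\<And>j. sets (b j) = sets (pair_I v)"
  shows "(\<lambda>n. payoff N G (\<lambda>j. if j \<in> A then mixture M (W n) (\<lambda>l. q l j) else b j))
    \<longlonglongrightarrow> payoff N G (\<lambda>j. if j \<in> A then mixture M w (\<lambda>l. q l j) else b j)"
  using A b
proof (induction A arbitrary: b)
  case (insert i A)
  define m where "m u b = (\<lambda>j. if j \<in> A then mixture M u (\<lambda>l. q l j) else b j)" for u b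
  have m: "prob_space (m u b j)" "sets (m u b j) = sets (pair_I v)"
    if "u \<in> simplex_weights M" "\<And>j. prob_space (b j)" "\<And>j. sets (b j) = sets (pair_I v)" for u b j
    using that prob_space_mixture[OF that(1) q] sets_mixture[OF that(1) q] by (simp_all add: m_def)
  have expand: "payoff N G (\<lambda>j. if j \<in> insert i A then mixture M u (\<lambda>l. q l j) else b j) =
      (\<Sum>l<M. u l * payoff N G (m u (b(i := q l i))))" if u: "u \<in> simplex_weights M" for u
  proof -
    have "(\<lambda>j. if j \<in> insert i A then mixture M u (\<lambda>l. q l j) else b j) =
        (m u b)(i := mixture M u (\<lambda>l. q l i))"
      by (auto simp: m_def)
    moreover have "(m u b)(i := q l i) = m u (b(i := q l i))" for l
      using insert.hyps by (auto simp: m_def)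
    moreover have "payoff N G ((m u b)(i := mixture M u (\<lambda>l. q l i))) =
        (\<Sum>l<M. u l * payoff N G ((m u b)(i := q l i)))"
      using m[OF u insert.prems(2,3)] insert.prems(1) u q by (intro payoff_affine) auto
    ultimately show ?thesis by simp
  qed
  have "(\<lambda>n. payoff N G (m (W n) (b(i := q l i)))) \<longlonglongrightarrow> payoff N G (m w (b(i := q l i)))"
    if "l < M" for l
    unfolding m_def using insert.prems q that by (intro insert.IH) auto
  then show ?case
    unfolding expand[OF W(1)] expand[OF W(2)] using lim by (intro tendsto_intros) auto
qed simp

end

section \<open>The selection rule\<close>

lemma top_sets_cong:
  assumes "\<And>i j. i < N \<Longrightarrow> j < N \<Longrightarrow> i \<noteq> j \<Longrightarrow> y j \<le> y i \<longleftrightarrow> z j \<le> z i"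
  shows "top_sets N k y = top_sets N k z"
proof -
  have "(\<forall>i\<in>T. \<forall>j\<in>{..<N} - T. y j \<le> y i) \<longleftrightarrow> (\<forall>i\<in>T. \<forall>j\<in>{..<N} - T. z j \<le> z i)"
    if "T \<subseteq> {..<N}" for T
    using that by (intro ball_cong refl assms) auto
  then show ?thesis unfolding top_sets_def by blast
qed

text \<open>There are finitely many possible values, so it suffices that each fibre is a finite
  Boolean combination of comparisons between two observations.\<close>

lemma measurable_top_sets:
  assumes a: "\<And>j. j < N \<Longrightarrow> (\<lambda>x. a x j) \<in> borel_measurable M"
  shows "(\<lambda>x. top_sets N k (a x)) \<in> measurable M (count_space UNIV)"
proof -
  have fin: "finite (Pow (Pow {..<N}))" by simp
  have mem: "{x \<in> space M. T \<in> top_sets N k (a x)} \<in> sets M" for T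
  proof (cases "T \<subseteq> {..<N} \<and> card T = k")
    case True
    then have "finite T" using finite_subset by blast
    have "{x \<in> space M. T \<in> top_sets N k (a x)} =
        {x \<in> space M. \<forall>i\<in>T. \<forall>j\<in>{..<N} - T. a x j \<le> a x i}"
      using True by (auto simp: top_sets_def)
    also have "\<dots> \<in> sets M"
      using True \<open>finite T\<close> a
      by (intro sets.sets_Collect_finite_All borel_measurable_le) auto
    finally show ?thesis .
  next
    case False
    then have "T \<notin> top_sets N k (a x)" for x unfolding top_sets_def by blast
    then show ?thesis by simp
  qed
  have sub: "top_sets N k (a x) \<subseteq> Pow {..<N}" for x
    unfolding top_sets_def by blast
  have "(\<lambda>x. top_sets N k (a x)) \<in> measurable M (count_space (Pow (Pow {..<N})))"
    unfolding measurable_count_space_eq2[OF fin]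
  proof (intro conjI ballI)
    fix \<T> assume \<T>: "\<T> \<in> Pow (Pow {..<N})"
    have "top_sets N k (a x) = \<T> \<longleftrightarrow> (\<forall>T\<in>Pow {..<N}. T \<in> top_sets N k (a x) \<longleftrightarrow> T \<in> \<T>)" for x
      using sub[of x] \<T> by blast
    then have "(\<lambda>x. top_sets N k (a x)) -` {\<T>} \<inter> space M =
        {x \<in> space M. \<forall>T\<in>Pow {..<N}. T \<in> top_sets N k (a x) \<longleftrightarrow> T \<in> \<T>}"
      by blast
    also have "\<dots> \<in> sets M"
    proof (rule sets.sets_Collect_finite_All)
      show "{x \<in> space M. T \<in> top_sets N k (a x) \<longleftrightarrow> T \<in> \<T>} \<in> sets M" for T
        using mem[of T] sets.sets_Collect_neg[OF mem[of T]] by (cases "T \<in> \<T>") simp_all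
    qed simp
    finally show "(\<lambda>x. top_sets N k (a x)) -` {\<T>} \<inter> space M \<in> sets M" .
  qed (use sub in blast)
  from measurable_compose[OF this, of "\<lambda>x. x" "count_space UNIV"] show ?thesis by simp
qed

lemma borel_measurable_selection_prob:
  assumes "\<And>j. j < N \<Longrightarrow> (\<lambda>x. m x j) \<in> borel_measurable M"
    and "\<And>j. j < N \<Longrightarrow> (\<lambda>x. \<xi> x j) \<in> borel_measurable M"
  shows "(\<lambda>x. selection_prob N k i (m x) (\<xi> x)) \<in> borel_measurable M"
proof -
  have "(\<lambda>x. top_sets N k (\<lambda>j. m x j * \<xi> x j)) \<in> measurable M (count_space UNIV)"
    by (intro measurable_top_sets borel_measurable_times assms)
  from measurable_compose[OF this, of "\<lambda>\<T>. measure_pmf.prob (pmf_of_set \<T>) {T. i \<in> T}" borel]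
  show ?thesis unfolding selection_prob_def by simp
qed

section \<open>Noise and the absence of ties\<close>

lemma sets_noise [simp, measurable_cong]: "sets (noise \<eta>) = sets borel"
  by (simp add: noise_def)

lemma prob_space_noise: "0 < \<eta> \<Longrightarrow> prob_space (noise \<eta>)"
  unfolding noise_def by (intro prob_space_uniform_measure) auto

lemma emeasure_noise_singleton: "emeasure (noise \<eta>) {c} = 0"
proof -
  have "emeasure lborel ({1 - \<eta>..1 + \<eta>} \<inter> {c}) \<le> emeasure lborel {c}"
    by (rule emeasure_mono) auto
  then show ?thesis by (simp add: noise_def)
qed

text \<open>With the other noises fixed, a tie forces \<open>\<xi> j\<close> to equal the single
  number \<open>a * \<xi> i / b\<close>, an event of probability 0. Here \<open>a\<close> and
  \<open>b\<close> stand for the messages of \<open>i\<close> and \<open>j\<close>.\<close>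

lemma AE_noise_no_tie:
  fixes i j N :: nat
  assumes "0 < \<eta>" "i < N" "j < N" "i \<noteq> j" "b \<noteq> 0"
  shows "AE \<xi> in PiM {..<N} (\<lambda>_. noise \<eta>). a * \<xi> i \<noteq> b * \<xi> j"
proof -
  interpret P: product_sigma_finite "\<lambda>_ :: nat. noise \<eta>"
    by (intro product_sigma_finite.intro prob_space_imp_sigma_finite prob_space_noise assms)
  define I where "I = {..<N} - {j}"
  have I: "finite I" "j \<notin> I" "{..<N} = insert j I" "i \<in> I" using assms by (auto simp: I_def)
  define f :: "(nat \<Rightarrow> real) \<Rightarrow> ennreal" where
    "f = (\<lambda>\<xi>. indicator {\<xi>. a * \<xi> i = b * \<xi> j} \<xi>)"
  have f: "f \<in> borel_measurable (PiM (insert j I) (\<lambda>_. noise \<eta>))"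
  proof -
    have [measurable]: "(\<lambda>\<xi>. \<xi> i) \<in> borel_measurable (PiM (insert j I) (\<lambda>_. noise \<eta>))"
      "(\<lambda>\<xi>. \<xi> j) \<in> borel_measurable (PiM (insert j I) (\<lambda>_. noise \<eta>))"
      using I measurable_component_singleton[of _ "insert j I" "\<lambda>_. noise \<eta>"]
      by (auto simp: measurable_cong_sets[OF refl sets_noise])
    have "f = (\<lambda>\<xi>. if a * \<xi> i = b * \<xi> j then 1 else 0)"
      by (auto simp: f_def)
    then show ?thesis by simp
  qed
  have "f (x(j := y)) = indicator {a * x i / b} y" for x y
    using assms I(2,4) by (auto simp: f_def field_simps split: split_indicator)
  then have "integral\<^sup>N (PiM (insert j I) (\<lambda>_. noise \<eta>)) f = 0"
    using emeasure_noise_singleton[of \<eta>] by (subst P.product_nn_integral_insert[OF I(1,2) f]) simp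
  then have "AE \<xi> in PiM (insert j I) (\<lambda>_. noise \<eta>). f \<xi> = 0"
    using nn_integral_0_iff_AE[OF f] by simp
  then show ?thesis
    unfolding I(3) by eventually_elim (auto simp: f_def split: split_indicator_asm)
qed

text \<open>Convergence is by eventual equality: for each of the finitely many pairs of agents the
  sign of the difference of observations settles.\<close>

lemma selection_prob_tendsto:
  assumes m: "\<And>j. j < N \<Longrightarrow> (\<lambda>n. m n j) \<longlonglongrightarrow> m' j"
    and no_tie: "\<And>i j. i < N \<Longrightarrow> j < N \<Longrightarrow> i \<noteq> j \<Longrightarrow> m' i * \<xi> i \<noteq> m' j * \<xi> j"
  shows "(\<lambda>n. selection_prob N k l (m n) \<xi>) \<longlonglongrightarrow> selection_prob N k l m' \<xi>"
proof -
  have pair: "\<forall>\<^sub>F n in sequentially. i \<noteq> j \<longrightarrow> (m n j * \<xi> j \<le> m n i * \<xi> i \<longleftrightarrow> m' j * \<xi> j \<le> m' i * \<xi> i)"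
    if ij: "i < N" "j < N" for i j
  proof (cases "i = j")
    case False
    have lim: "(\<lambda>n. m n i * \<xi> i - m n j * \<xi> j) \<longlonglongrightarrow> m' i * \<xi> i - m' j * \<xi> j"
      using m ij by (intro tendsto_intros) auto
    consider "0 < m' i * \<xi> i - m' j * \<xi> j" | "m' i * \<xi> i - m' j * \<xi> j < 0"
      using no_tie[OF ij False] by linarith
    then show ?thesis
    proof cases
      case 1
      from order_tendstoD(1)[OF lim 1] show ?thesis
        by eventually_elim (use 1 in auto)
    next
      case 2
      from order_tendstoD(2)[OF lim 2] show ?thesis
        by eventually_elim (use 2 in auto)
    qed
  qed simp
  have "\<forall>\<^sub>F n in sequentially. \<forall>i\<in>{..<N}. \<forall>j\<in>{..<N}. i \<noteq> j \<longrightarrow>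
      (m n j * \<xi> j \<le> m n i * \<xi> i \<longleftrightarrow> m' j * \<xi> j \<le> m' i * \<xi> i)"
    using pair by (intro eventually_ball_finite ballI) auto
  then have "\<forall>\<^sub>F n in sequentially. selection_prob N k l (m n) \<xi> = selection_prob N k l m' \<xi>"
  proof eventually_elim
    case (elim n)
    then have "top_sets N k (\<lambda>j. m n j * \<xi> j) = top_sets N k (\<lambda>j. m' j * \<xi> j)"
      by (intro top_sets_cong) auto
    then show ?case by (simp add: selection_prob_def)
  qed
  then show ?thesis by (rule tendsto_eventually)
qed

section \<open>Payoffs averaged over the noise\<close>

definition interim_payoff ::
  "nat \<Rightarrow> nat \<Rightarrow> real \<Rightarrow> (nat \<Rightarrow> real \<Rightarrow> real) \<Rightarrow> nat \<Rightarrow> (nat \<Rightarrow> real \<times> real) \<Rightarrow> real" where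
  "interim_payoff N k \<eta> u i x =
     (\<integral>\<xi>. selection_prob N k i (\<lambda>j. snd (x j)) \<xi> * u i (fst (x i)) \<partial>PiM {..<N} (\<lambda>_. noise \<eta>))"

context
  fixes N k i :: nat and v \<eta> :: real and u :: "nat \<Rightarrow> real \<Rightarrow> real"
  assumes i: "i < N" and v: "0 < v" and \<eta>: "0 < \<eta>" and u: "continuous_on {v..1} (u i)"
begin

lemma integrand_measurable:
  "(\<lambda>z. selection_prob N k i (\<lambda>j. snd (fst z j)) (snd z) * u i (fst (fst z i)))
     \<in> borel_measurable (PiM {..<N} (\<lambda>_. pair_I v) \<Otimes>\<^sub>M PiM {..<N} (\<lambda>_. noise \<eta>))"
proof (intro borel_measurable_times borel_measurable_selection_prob)
  let ?P = "PiM {..<N} (\<lambda>_. pair_I v) \<Otimes>\<^sub>M PiM {..<N} (\<lambda>_. noise \<eta>)"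
  have comp: "(\<lambda>z. fst z j) \<in> measurable ?P (pair_I v)" if "j < N" for j
    using that by (intro measurable_compose[OF measurable_fst] measurable_component_singleton) simp
  show "(\<lambda>z. snd (fst z j)) \<in> borel_measurable ?P" if "j < N" for j
    by (rule measurable_compose[OF comp[OF that] measurable_pair_I_snd])
  show "(\<lambda>z. snd z j) \<in> borel_measurable ?P" if "j < N" for j
  proof -
    have "(\<lambda>z. snd z j) \<in> measurable ?P (noise \<eta>)"
      using that by (intro measurable_compose[OF measurable_snd] measurable_component_singleton) simp
    then show ?thesis by (simp add: measurable_cong_sets[OF refl sets_noise])
  qed
  show "(\<lambda>z. u i (fst (fst z i))) \<in> borel_measurable ?P"
    by (rule measurable_compose[OF measurable_compose[OF comp[OF i] measurable_fst]
      borel_measurable_continuous_on_I[OF u]])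
qed

lemma utility_bound: "\<exists>C. \<forall>a\<in>{v..1}. \<bar>u i a\<bar> \<le> C"
proof -
  have "bounded (u i ` {v..1})"
    by (intro compact_imp_bounded compact_continuous_image u compact_Icc)
  then show ?thesis unfolding bounded_iff by auto
qed

lemma integrand_bound:
  assumes "\<bar>u i a\<bar> \<le> C"
  shows "\<bar>selection_prob N k i m \<xi> * u i a\<bar> \<le> C"
proof -
  have "0 \<le> selection_prob N k i m \<xi>" "selection_prob N k i m \<xi> \<le> 1"
    by (simp_all add: selection_prob_def)
  then have "\<bar>selection_prob N k i m \<xi> * u i a\<bar> \<le> 1 * \<bar>u i a\<bar>"
    unfolding abs_mult by (intro mult_right_mono) auto
  with assms show ?thesis by simp
qed

text \<open>The noise law is the same for all profiles and independent of them, so Fubini integrates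
  it out once and for all.\<close>

lemma expected_utility_eq_payoff:
  assumes "\<And>j. prob_space (\<pi> j)" "\<And>j. sets (\<pi> j) = sets (pair_I v)"
  shows "expected_utility N k \<eta> u i \<pi> = payoff N (interim_payoff N k \<eta> u i) \<pi>"
proof -
  let ?X = "PiM {..<N} \<pi>" and ?E = "PiM {..<N} (\<lambda>_. noise \<eta>)"
  interpret X: prob_space ?X by (intro prob_space_PiM assms)
  interpret E: prob_space ?E by (intro prob_space_PiM prob_space_noise \<eta>)
  interpret pair_prob_space ?X ?E ..
  obtain C where C: "\<And>a. a \<in> {v..1} \<Longrightarrow> \<bar>u i a\<bar> \<le> C" using utility_bound by blast
  have sets_X: "sets ?X = sets (PiM {..<N} (\<lambda>_. pair_I v))"
    using assms by (intro sets_PiM_cong) auto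
  have "(\<lambda>z. selection_prob N k i (\<lambda>j. snd (fst z j)) (snd z) * u i (fst (fst z i)))
      \<in> borel_measurable (?X \<Otimes>\<^sub>M ?E)"
    using integrand_measurable
    by (subst measurable_cong_sets[OF sets_pair_measure_cong[OF sets_X refl] refl])
  moreover have "fst (fst z i) \<in> {v..1}" if "z \<in> space (?X \<Otimes>\<^sub>M ?E)" for z
    using that i sets_eq_imp_space_eq[OF sets_X]
    by (auto simp: space_pair_measure space_PiM PiE_iff dest!: bspec[of _ _ i])
  ultimately have "integrable (?X \<Otimes>\<^sub>M ?E)
      (\<lambda>z. selection_prob N k i (\<lambda>j. snd (fst z j)) (snd z) * u i (fst (fst z i)))"
    using C integrand_bound
    by (intro integrable_const_bound[where B = C]) (auto intro!: AE_I2)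
  from integral_fst'[OF this] show ?thesis
    by (simp add: expected_utility_def payoff_def interim_payoff_def case_prod_beta')
qed

lemma regular_interim_payoff:
  shows "\<exists>C. regular_payoff N v (interim_payoff N k \<eta> u i) C"
proof -
  let ?E = "PiM {..<N} (\<lambda>_. noise \<eta>)" and ?X = "PiM {..<N} (\<lambda>_. pair_I v)"
  interpret E: prob_space ?E by (intro prob_space_PiM prob_space_noise \<eta>)
  obtain C where C: "\<And>a. a \<in> {v..1} \<Longrightarrow> \<bar>u i a\<bar> \<le> C" using utility_bound by blast
  have section_meas: "(\<lambda>\<xi>. selection_prob N k i m \<xi> * c) \<in> borel_measurable ?E" for m c
  proof (intro borel_measurable_times borel_measurable_selection_prob)
    show "(\<lambda>\<xi>. \<xi> j) \<in> borel_measurable ?E" if "j < N" for j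
    proof -
      have "(\<lambda>\<xi>. \<xi> j) \<in> measurable ?E (noise \<eta>)"
        using that by (intro measurable_component_singleton) simp
      then show ?thesis by (simp add: measurable_cong_sets[OF refl sets_noise])
    qed
  qed auto
  have "regular_payoff N v (interim_payoff N k \<eta> u i) C"
  proof
    show "interim_payoff N k \<eta> u i \<in> borel_measurable ?X"
      unfolding interim_payoff_def[abs_def] using integrand_measurable
      by (intro E.borel_measurable_lebesgue_integral) (simp add: case_prod_beta')
  next
    fix x assume "x \<in> space ?X"
    then have xi: "fst (x i) \<in> {v..1}"
      using i by (auto simp: space_PiM PiE_iff space_pair_measure dest!: bspec[of _ _ i])
    have "\<bar>interim_payoff N k \<eta> u i x\<bar> \<le>
        (\<integral>\<xi>. \<bar>selection_prob N k i (\<lambda>j. snd (x j)) \<xi> * u i (fst (x i))\<bar> \<partial>?E)"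
      unfolding interim_payoff_def by (rule integral_abs_bound)
    also have "\<dots> \<le> (\<integral>\<xi>. C \<partial>?E)"
    proof (rule integral_mono)
      show "integrable ?E (\<lambda>\<xi>. \<bar>selection_prob N k i (\<lambda>j. snd (x j)) \<xi> * u i (fst (x i))\<bar>)"
        using section_meas integrand_bound[OF C[OF xi]]
        by (intro integrable_abs E.integrable_const_bound[where B = C]) (auto intro!: AE_I2)
    qed (use integrand_bound[OF C[OF xi]] in auto)
    finally show "\<bar>interim_payoff N k \<eta> u i x\<bar> \<le> C" by (simp add: E.prob_space)
  next
    fix X :: "nat \<Rightarrow> nat \<Rightarrow> real \<times> real" and x
    assume X: "\<And>n j. j < N \<Longrightarrow> X n j \<in> {v..1} \<times> {v..1}"
      and x: "\<And>j. j < N \<Longrightarrow> x j \<in> {v..1} \<times> {v..1}"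
      and lim: "\<And>j. j < N \<Longrightarrow> (\<lambda>n. X n j) \<longlonglongrightarrow> x j"
    have ui: "(\<lambda>n. u i (fst (X n i))) \<longlonglongrightarrow> u i (fst (x i))"
      using X[OF i] x[OF i]
      by (intro continuous_on_tendsto_compose[OF u] tendsto_fst lim i)
        (auto simp: mem_Times_iff intro!: always_eventually)
    \<comment> \<open>Only ties at the limit profile \<open>x\<close> have to be excluded, so one
      null set serves the whole sequence.\<close>
    have "AE \<xi> in ?E. \<forall>a\<in>{..<N}. \<forall>b\<in>{..<N}. a \<noteq> b \<longrightarrow> snd (x a) * \<xi> a \<noteq> snd (x b) * \<xi> b"
    proof (intro AE_finite_allI)
      fix a b assume ab: "a \<in> {..<N}" "b \<in> {..<N}"
      have "snd (x b) \<noteq> 0" using x[of b] ab v by (auto simp: mem_Times_iff)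
      then show "AE \<xi> in ?E. a \<noteq> b \<longrightarrow> snd (x a) * \<xi> a \<noteq> snd (x b) * \<xi> b"
        using AE_noise_no_tie[OF \<eta>, of a N b "snd (x b)" "snd (x a)"] ab
        by (cases "a = b") auto
    qed auto
    then have "AE \<xi> in ?E. (\<lambda>n. selection_prob N k i (\<lambda>j. snd (X n j)) \<xi> * u i (fst (X n i)))
        \<longlonglongrightarrow> selection_prob N k i (\<lambda>j. snd (x j)) \<xi> * u i (fst (x i))"
      by eventually_elim (intro tendsto_mult ui selection_prob_tendsto tendsto_snd lim; auto)
    then show "(\<lambda>n. interim_payoff N k \<eta> u i (X n)) \<longlonglongrightarrow> interim_payoff N k \<eta> u i x"
      unfolding interim_payoff_def
    proof (intro integral_dominated_convergence[where w = "\<lambda>_. C"] section_meas)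
      show "AE \<xi> in ?E. norm (selection_prob N k i (\<lambda>j. snd (X n j)) \<xi> * u i (fst (X n i))) \<le> C" for n
        using integrand_bound[OF C] X[OF i] by (auto intro!: AE_I2 simp: mem_Times_iff)
    qed simp
  qed
  then show ?thesis ..
qed

end

section \<open>Existence of an equilibrium\<close>

theorem theoremB1:
  fixes N k :: nat and vmin \<eta> :: real
    and F :: "nat \<Rightarrow> real measure" and u :: "nat \<Rightarrow> real \<Rightarrow> real"
  assumes "1 \<le> k" and "k \<le> N"
    and "0 < vmin" and "vmin < 1"
    and "0 < \<eta>" and "\<eta> < 1"
    and "\<And>i. i < N \<Longrightarrow> is_prior vmin (F i)"
    and "\<And>i. i < N \<Longrightarrow> continuous_on {vmin..1} (u i)"
    and "\<And>i. i < N \<Longrightarrow> mono_on {vmin..1} (u i)"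
    and "\<And>i v. i < N \<Longrightarrow> v \<in> {vmin..1} \<Longrightarrow> 0 \<le> u i v"
  shows "\<exists>\<pi>. nash_equilibrium {..<N} (\<lambda>i. strategies vmin (F i)) (expected_utility N k \<eta> u) \<pi>"
proof -
  have "0 < N" using assms(1,2) by simp
  have v: "0 \<le> vmin" "vmin \<le> 1" using assms by auto
  define H where "H i = interim_payoff N k \<eta> u i" for i
  have "\<exists>C. regular_payoff N vmin (H i) C" if "i < N" for i
    unfolding H_def using that assms by (intro regular_interim_payoff)
  then obtain C where H: "\<And>i. i < N \<Longrightarrow> regular_payoff N vmin (H i) (C i)" by metis
  have "strategies vmin (F 0) \<noteq> {}"
    using assms(7)[OF \<open>0 < N\<close>] by (rule strategies_nonempty)
  then obtain p0 where p0: "p0 \<in> strategies vmin (F 0)" by blast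
  \<comment> \<open>Profiles are total functions, and the payoff lemmas ask for a probability
    measure at every index; the indices from \<open>N\<close> on carry the fixed
    \<open>p0\<close>.\<close>
  define S where "S j = (if j < N then strategies vmin (F j) else {p0})" for j
  have S: "prob_space p" "sets p = sets (pair_I vmin)" if "p \<in> S j" for p j
    using that p0 by (auto simp: S_def strategies_def split: if_splits)
  have S_nonempty: "\<exists>p. p \<in> S j" for j
    using strategies_nonempty[OF assms(7)[of j]] by (auto simp: S_def)
  define X where "X = {\<pi>. \<forall>j. \<pi> j \<in> S j}"
  have XD: "\<pi> j \<in> S j" if "\<pi> \<in> X" for \<pi> j using that by (simp add: X_def)
  have Xps: "prob_space (\<pi> j)" and Xsets: "sets (\<pi> j) = sets (pair_I vmin)" if "\<pi> \<in> X" for \<pi> j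
    using S[OF XD[OF that]] by auto
  define L where "L \<sigma> \<pi> \<longleftrightarrow> (\<forall>j. skorohod_limit vmin (\<lambda>n. \<sigma> n j) (\<pi> j))"
    for \<sigma> :: "nat \<Rightarrow> nat \<Rightarrow> (real \<times> real) measure" and \<pi>
  define \<psi> where "\<psi> \<pi> \<rho> = (\<Sum>i<N. payoff N (H i) (\<pi>(i := \<rho> i)) - payoff N (H i) \<pi>)" for \<pi> \<rho>
  define mix where "mix M w q = (\<lambda>j. if j < N then mixture M w (\<lambda>l. q l j) else p0)"
    for M w and q :: "nat \<Rightarrow> nat \<Rightarrow> (real \<times> real) measure"
  have "\<exists>\<pi>\<in>X. \<forall>\<rho>\<in>X. \<psi> \<pi> \<rho> \<le> 0"
  proof (rule ky_fan_seq_compact[of X L \<psi> mix])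
    show "X \<noteq> {}" using choice[of "\<lambda>j p. p \<in> S j"] S_nonempty by (auto simp: X_def)
  next
    fix \<sigma> :: "nat \<Rightarrow> nat \<Rightarrow> (real \<times> real) measure" assume \<sigma>: "\<And>n. \<sigma> n \<in> X"
    define P where "P j s \<longleftrightarrow> (\<exists>p\<in>S j. skorohod_limit vmin (\<lambda>n. \<sigma> (s n) j) p)" for j s
    have "\<exists>r. strict_mono r \<and> (\<forall>j<N. P j r)"
    proof (rule finite_common_subseq)
      fix j and s :: "nat \<Rightarrow> nat" assume j: "j < N"
      obtain r p where r: "strict_mono r" and lim: "skorohod_limit vmin ((\<lambda>n. \<sigma> (s n) j) \<circ> r) p"
        using skorohod_limit_compact[OF v, of "\<lambda>n. \<sigma> (s n) j"] Xps[OF \<sigma>] Xsets[OF \<sigma>] by blast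
      have "\<sigma> n j \<in> strategies vmin (F j)" for n
        using XD[OF \<sigma>, of n j] j by (simp add: S_def)
      then have "p \<in> strategies vmin (F j)"
        by (intro strategies_closed[OF lim _ assms(7)[OF j]]) simp
      with r lim j show "\<exists>r. strict_mono r \<and> P j (s \<circ> r)"
        by (auto simp: P_def S_def comp_def)
    next
      fix j s and r :: "nat \<Rightarrow> nat" assume "P j s" "strict_mono r"
      then show "P j (s \<circ> r)"
        unfolding P_def using skorohod_limit_subseq by (fastforce simp: comp_def)
    qed
    then obtain r where r: "strict_mono r" and "\<forall>j<N. P j r" by blast
    moreover have "P j r" if "\<not> j < N" for j
    proof -
      have "\<sigma> (r n) j = p0" for n using XD[OF \<sigma>, of "r n" j] that by (simp add: S_def)
      moreover have "p0 \<in> S j" using that by (simp add: S_def)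
      ultimately show ?thesis
        unfolding P_def using skorohod_limit_const[OF v, of p0] S by auto
    qed
    ultimately have "\<forall>j. P j r" by blast
    then have "\<forall>j. \<exists>p. p \<in> S j \<and> skorohod_limit vmin (\<lambda>n. \<sigma> (r n) j) p"
      unfolding P_def by blast
    from choice[OF this] obtain p where "\<forall>j. p j \<in> S j \<and> skorohod_limit vmin (\<lambda>n. \<sigma> (r n) j) (p j)" ..
    then have "p \<in> X" "L (\<sigma> \<circ> r) p" by (auto simp: X_def L_def)
    with r show "\<exists>r x. strict_mono (r :: nat \<Rightarrow> nat) \<and> x \<in> X \<and> L (\<sigma> \<circ> r) x" by blast
  next
    fix \<sigma> \<pi> and r :: "nat \<Rightarrow> nat" assume "L \<sigma> \<pi>" "strict_mono r"
    then show "L (\<sigma> \<circ> r) \<pi>"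
      unfolding L_def using skorohod_limit_subseq[of vmin "\<lambda>n. \<sigma> n j" for j] by (simp add: comp_def)
  next
    fix \<pi> assume "\<pi> \<in> X"
    then show "L (\<lambda>_. \<pi>) \<pi>"
      unfolding L_def by (intro allI skorohod_limit_const v Xps Xsets)
  next
    fix \<sigma> \<tau> \<pi> \<rho> assume "L \<sigma> \<pi>" "L \<tau> \<rho>"
    then have "\<And>j. skorohod_limit vmin (\<lambda>n. \<sigma> n j) (\<pi> j)"
      "\<And>j. skorohod_limit vmin (\<lambda>n. ((\<sigma> n)(i := \<tau> n i)) j) ((\<pi>(i := \<rho> i)) j)" for i
      by (auto simp: L_def)
    then show "(\<lambda>n. \<psi> (\<sigma> n) (\<tau> n)) \<longlonglongrightarrow> \<psi> \<pi> \<rho>"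
      unfolding \<psi>_def by (intro tendsto_sum tendsto_diff regular_payoff.payoff_tendsto[OF H]) auto
  next
    fix w M and q :: "nat \<Rightarrow> nat \<Rightarrow> (real \<times> real) measure"
    assume w: "w \<in> simplex_weights M" and q: "\<And>l. l < M \<Longrightarrow> q l \<in> X"
    have "mixture M w (\<lambda>l. q l j) \<in> strategies vmin (F j)" if j: "j < N" for j
    proof (intro mixture_strategies w assms(7) j)
      show "q l j \<in> strategies vmin (F j)" if "l < M" for l
        using XD[OF q[OF that], of j] j by (simp add: S_def)
    qed
    then have "mix M w q \<in> X" by (simp add: X_def S_def mix_def)
    moreover have "\<psi> \<pi> (mix M w q) = (\<Sum>l<M. w l * \<psi> \<pi> (q l))" if \<pi>: "\<pi> \<in> X" for \<pi>
    proof -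
      have w1: "(\<Sum>l<M. w l) = 1" using w by (simp add: simplex_weights_def)
      have "payoff N (H i) (\<pi>(i := mix M w q i)) - payoff N (H i) \<pi> =
          (\<Sum>l<M. w l * (payoff N (H i) (\<pi>(i := q l i)) - payoff N (H i) \<pi>))" if i: "i < N" for i
      proof -
        have "payoff N (H i) (\<pi>(i := mixture M w (\<lambda>l. q l i))) =
            (\<Sum>l<M. w l * payoff N (H i) (\<pi>(i := q l i)))"
          by (intro regular_payoff.payoff_affine[OF H[OF i]] Xps[OF \<pi>] Xsets[OF \<pi>] i w
            Xps[OF q] Xsets[OF q])
        then have "payoff N (H i) (\<pi>(i := mix M w q i)) =
            (\<Sum>l<M. w l * payoff N (H i) (\<pi>(i := q l i)))"
          using i by (simp add: mix_def)
        \<comment> \<open>The weights sum to 1, so the payoff without deviation may be moved under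
          the sum.\<close>
        then show ?thesis
          using w1 by (simp add: right_diff_distrib sum_subtractf flip: sum_distrib_right)
      qed
      then have "\<psi> \<pi> (mix M w q) =
          (\<Sum>i<N. \<Sum>l<M. w l * (payoff N (H i) (\<pi>(i := q l i)) - payoff N (H i) \<pi>))"
        unfolding \<psi>_def by simp
      also have "\<dots> = (\<Sum>l<M. w l * \<psi> \<pi> (q l))"
        unfolding \<psi>_def by (subst sum.swap) (simp add: sum_distrib_left)
      finally show ?thesis .
    qed
    ultimately show "mix M w q \<in> X \<and> (\<forall>\<pi>\<in>X. \<psi> \<pi> (mix M w q) = (\<Sum>l<M. w l * \<psi> \<pi> (q l)))"
      by blast
  next
    fix W w M \<rho> and q :: "nat \<Rightarrow> nat \<Rightarrow> (real \<times> real) measure"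
    assume W: "\<And>n. W n \<in> simplex_weights M" "w \<in> simplex_weights M"
      and q: "\<And>l. l < M \<Longrightarrow> q l \<in> X" and \<rho>: "\<rho> \<in> X"
      and lim: "\<And>l. l < M \<Longrightarrow> (\<lambda>n. W n l) \<longlonglongrightarrow> w l"
    have p0': "prob_space p0" "sets p0 = sets (pair_I vmin)"
      using p0 by (auto simp: strategies_def)
    \<comment> \<open>When agent \<open>i\<close> deviates, coordinate \<open>i\<close> is no longer
      mixed: it leaves the set \<open>A\<close> of \<open>payoff_mixture_tendsto\<close>, and
      \<open>\<rho> i\<close> enters through the base profile.\<close>
    have mix_eq: "mix M z q = (\<lambda>j. if j \<in> {..<N} then mixture M z (\<lambda>l. q l j) else p0)"
      "(mix M z q)(i := \<rho> i) =
        (\<lambda>j. if j \<in> {..<N} - {i} then mixture M z (\<lambda>l. q l j) else ((\<lambda>_. p0)(i := \<rho> i)) j)" for z i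
      by (auto simp: mix_def)
    show "(\<lambda>n. \<psi> (mix M (W n) q) \<rho>) \<longlonglongrightarrow> \<psi> (mix M w q) \<rho>"
      unfolding \<psi>_def
    proof (intro tendsto_sum tendsto_diff)
      fix i assume "i \<in> {..<N}"
      then have i: "i < N" by simp
      show "(\<lambda>n. payoff N (H i) (mix M (W n) q)) \<longlonglongrightarrow> payoff N (H i) (mix M w q)"
        unfolding mix_eq(1)
        by (rule regular_payoff.payoff_mixture_tendsto[OF H[OF i] W lim])
          (use q Xps Xsets p0' in auto)
      show "(\<lambda>n. payoff N (H i) ((mix M (W n) q)(i := \<rho> i))) \<longlonglongrightarrow>
          payoff N (H i) ((mix M w q)(i := \<rho> i))"
        unfolding mix_eq(2)
        by (rule regular_payoff.payoff_mixture_tendsto[OF H[OF i] W lim])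
          (use q \<rho> Xps Xsets p0' in auto)
    qed
  qed (simp add: \<psi>_def)
  then obtain \<pi> where \<pi>: "\<pi> \<in> X" and le: "\<And>\<rho>. \<rho> \<in> X \<Longrightarrow> \<psi> \<pi> \<rho> \<le> 0" by blast
  have U: "expected_utility N k \<eta> u i \<rho> = payoff N (H i) \<rho>" if i: "i < N" and \<rho>: "\<rho> \<in> X" for i \<rho>
    unfolding H_def
    by (rule expected_utility_eq_payoff[where u = u and \<pi> = \<rho>, OF i assms(3,5) assms(8)[OF i] Xps[OF \<rho>] Xsets[OF \<rho>]])
  have "expected_utility N k \<eta> u i (\<pi>(i := p)) \<le> expected_utility N k \<eta> u i \<pi>"
    if i: "i < N" and p: "p \<in> strategies vmin (F i)" for i p
  proof -
    have "p \<in> S i" using i p by (simp add: S_def)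
    with \<pi> have X': "\<pi>(i := p) \<in> X" by (simp add: X_def)
    \<comment> \<open>A deviation of agent \<open>i\<close> alone leaves the other summands of
      \<psi> at 0, so the value of \<psi> is exactly the gain of agent \<open>i\<close>.\<close>
    have "payoff N (H j) (\<pi>(j := (\<pi>(i := p)) j)) - payoff N (H j) \<pi> =
        (if j = i then payoff N (H i) (\<pi>(i := p)) - payoff N (H i) \<pi> else 0)" for j
      by simp
    then have "\<psi> \<pi> (\<pi>(i := p)) = payoff N (H i) (\<pi>(i := p)) - payoff N (H i) \<pi>"
      unfolding \<psi>_def using i by simp
    with le[OF X'] show ?thesis using U[OF i] \<pi> X' by simp
  qed
  moreover have "\<pi> i \<in> strategies vmin (F i)" if "i < N" for i
    using XD[OF \<pi>, of i] that by (simp add: S_def)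
  ultimately show ?thesis
    unfolding nash_equilibrium_def by blast
qed

end
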